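(* The diagonal subalgebra $\mathcal{D}_2\subset\mathcal{Q}_2$ is a maximal abelian subalgebra of $\mathcal{Q}_2$.
   Context: The $2$-adic ring $C^*$-algebra $\mathcal{Q}_2$ is the universal (unital) $C^*$-algebra generated by a unitary $U$ and an isometry $S_2$ satisfying $S_2U=U^2S_2$ and $S_2S_2^*+US_2S_2^*U^*=1$. Put $S_1:=US_2$. For a multi-index $\mu=(\mu_1,\dots,\mu_n)$ with $\mu_i\in\{1,2\}$, write $|\mu|=n$ and $S_\mu:=S_{\mu_1}\cdots S_{\mu_n}$. The diagonal subalgebra $\mathcal{D}_2$ is the $C^*$-subalgebra of $\mathcal{Q}_2$ given by the closed linear span of the projections $S_\mu S_\mu^*$, where $\mu$ ranges over all finite multi-indices in $\{1,2\}$. *)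

theory Defs
  imports "HOL-Analysis.Abstract_Metric_Spaces" "HOL-Algebra.Module"
begin

section \<open>Unital C*-algebras with explicit carriers\<close>

definition complex_ring :: "complex ring" where
  "complex_ring = \<lparr>carrier = UNIV, mult = (*), one = 1, zero = 0, add = (+)\<rparr>"

record 'a cstar = "(complex, 'a) module" +
  star :: "'a \<Rightarrow> 'a" (\<open>_\<^sup>\<star>\<index>\<close> [1000] 999)
  nrm :: "'a \<Rightarrow> real"

text \<open>The value 0 off the carrier makes \<open>cstar_dist A\<close> satisfy the axioms of
  \<^locale>\<open>Metric_space\<close>, two of which range over the whole type.\<close>

definition cstar_dist :: "'a cstar \<Rightarrow> 'a \<Rightarrow> 'a \<Rightarrow> real" where
  "cstar_dist A x y =
     (if x \<in> carrier A \<and> y \<in> carrier A then nrm A (x \<ominus>\<^bsub>A\<^esub> y) else 0)"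

abbreviation cstar_topology :: "'a cstar \<Rightarrow> 'a topology" where
  "cstar_topology A \<equiv> Metric_space.mtopology (carrier A) (cstar_dist A)"

text \<open>The locale \<open>algebra\<close> of HOL-Algebra is for commutative algebras, so the compatibility of
  the product with scalars is spelled out. The zero algebra is admitted.\<close>

locale cstar_algebra = ring A + lin: Module.module complex_ring A
  for A :: "'a cstar" (structure) +
  assumes smult_mult_left:
      "\<lbrakk>x \<in> carrier A; y \<in> carrier A\<rbrakk> \<Longrightarrow> (c \<odot> x) \<otimes> y = c \<odot> (x \<otimes> y)"
    and smult_mult_right:
      "\<lbrakk>x \<in> carrier A; y \<in> carrier A\<rbrakk> \<Longrightarrow> x \<otimes> (c \<odot> y) = c \<odot> (x \<otimes> y)"
    and star_closed: "x \<in> carrier A \<Longrightarrow> x\<^sup>\<star> \<in> carrier A"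
    and star_star: "x \<in> carrier A \<Longrightarrow> (x\<^sup>\<star>)\<^sup>\<star> = x"
    and star_add: "\<lbrakk>x \<in> carrier A; y \<in> carrier A\<rbrakk> \<Longrightarrow> (x \<oplus> y)\<^sup>\<star> = x\<^sup>\<star> \<oplus> y\<^sup>\<star>"
    and star_smult: "x \<in> carrier A \<Longrightarrow> (c \<odot> x)\<^sup>\<star> = cnj c \<odot> x\<^sup>\<star>"
    and star_mult: "\<lbrakk>x \<in> carrier A; y \<in> carrier A\<rbrakk> \<Longrightarrow> (x \<otimes> y)\<^sup>\<star> = y\<^sup>\<star> \<otimes> x\<^sup>\<star>"
    and nrm_nonneg: "x \<in> carrier A \<Longrightarrow> 0 \<le> nrm A x"
    and nrm_eq_0: "x \<in> carrier A \<Longrightarrow> nrm A x = 0 \<longleftrightarrow> x = \<zero>"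
    and nrm_triangle: "\<lbrakk>x \<in> carrier A; y \<in> carrier A\<rbrakk> \<Longrightarrow> nrm A (x \<oplus> y) \<le> nrm A x + nrm A y"
    and nrm_smult: "x \<in> carrier A \<Longrightarrow> nrm A (c \<odot> x) = cmod c * nrm A x"
    and nrm_mult: "\<lbrakk>x \<in> carrier A; y \<in> carrier A\<rbrakk> \<Longrightarrow> nrm A (x \<otimes> y) \<le> nrm A x * nrm A y"
    and cstar_identity: "x \<in> carrier A \<Longrightarrow> nrm A (x\<^sup>\<star> \<otimes> x) = (nrm A x)\<^sup>2"
    and complete: "Metric_space.mcomplete (carrier A) (cstar_dist A)"
begin

lemma Metric_space_cstar_dist: "Metric_space (carrier A) (cstar_dist A)"
proof
  fix x y z
  show "0 \<le> cstar_dist A x y"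
    by (simp add: cstar_dist_def nrm_nonneg)
  have "nrm A (x \<ominus> y) = nrm A (y \<ominus> x)" if "x \<in> carrier A" "y \<in> carrier A"
  proof -
    have one: "\<one>\<^bsub>complex_ring\<^esub> = 1" and carr: "carrier complex_ring = UNIV"
      by (simp_all add: complex_ring_def)
    have "\<ominus>\<^bsub>complex_ring\<^esub> 1 \<oplus>\<^bsub>complex_ring\<^esub> 1 = \<zero>\<^bsub>complex_ring\<^esub>"
      by (rule lin.R.l_neg) (simp add: carr)
    then have neg: "\<ominus>\<^bsub>complex_ring\<^esub> 1 = -1"
      by (simp add: complex_ring_def add_eq_0_iff2)
    have "(-1) \<odot> (x \<ominus> y) = \<ominus> (x \<ominus> y)"
      using lin.smult_l_minus[of 1 "x \<ominus> y"] lin.smult_one[of "x \<ominus> y"] that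
      by (simp add: carr neg one)
    also have "\<dots> = y \<ominus> x"
      using that minus_add[of x "\<ominus> y"] a_comm[of "\<ominus> x" y] by (simp add: a_minus_def)
    finally show ?thesis
      using nrm_smult[of "x \<ominus> y" "-1"] that by simp
  qed
  then show "cstar_dist A x y = cstar_dist A y x"
    by (simp add: cstar_dist_def)
  show "cstar_dist A x y = 0 \<longleftrightarrow> x = y" if "x \<in> carrier A" "y \<in> carrier A"
    using that by (simp add: cstar_dist_def nrm_eq_0)
      (metis a_minus_def minus_equality minus_minus a_inv_closed r_neg)
  show "cstar_dist A x z \<le> cstar_dist A x y + cstar_dist A y z"
    if "x \<in> carrier A" "y \<in> carrier A" "z \<in> carrier A"
  proof -
    have "x \<ominus> z = (x \<ominus> y) \<oplus> (y \<ominus> z)"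
      using that by (simp add: a_minus_def a_assoc r_neg1)
    then show ?thesis
      using that nrm_triangle[of "x \<ominus> y" "y \<ominus> z"] by (simp add: cstar_dist_def)
  qed
qed

end

definition star_hom :: "'a cstar \<Rightarrow> 'b cstar \<Rightarrow> ('a \<Rightarrow> 'b) set" where
  "star_hom A B = {\<phi> \<in> ring_hom A B.
     (\<forall>c. \<forall>x\<in>carrier A. \<phi> (c \<odot>\<^bsub>A\<^esub> x) = c \<odot>\<^bsub>B\<^esub> \<phi> x) \<and>
     (\<forall>x\<in>carrier A. \<phi> (x\<^sup>\<star>\<^bsub>A\<^esub>) = (\<phi> x)\<^sup>\<star>\<^bsub>B\<^esub>)}"

definition cstar_subalgebra :: "'a cstar \<Rightarrow> 'a set \<Rightarrow> bool" where
  "cstar_subalgebra A D \<longleftrightarrow>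
     submodule D complex_ring A \<and>
     (\<forall>x\<in>D. \<forall>y\<in>D. x \<otimes>\<^bsub>A\<^esub> y \<in> D) \<and>
     (\<forall>x\<in>D. x\<^sup>\<star>\<^bsub>A\<^esub> \<in> D) \<and>
     closedin (cstar_topology A) D"

definition abelian_cstar_subalgebra :: "'a cstar \<Rightarrow> 'a set \<Rightarrow> bool" where
  "abelian_cstar_subalgebra A D \<longleftrightarrow>
     cstar_subalgebra A D \<and> (\<forall>x\<in>D. \<forall>y\<in>D. x \<otimes>\<^bsub>A\<^esub> y = y \<otimes>\<^bsub>A\<^esub> x)"

definition maximal_abelian_subalgebra :: "'a cstar \<Rightarrow> 'a set \<Rightarrow> bool" where
  "maximal_abelian_subalgebra A D \<longleftrightarrow>
     abelian_cstar_subalgebra A D \<and>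
     (\<forall>C. abelian_cstar_subalgebra A C \<and> D \<subseteq> C \<longrightarrow> C = D)"

definition closed_linear_span :: "'a cstar \<Rightarrow> 'a set \<Rightarrow> 'a set" where
  "closed_linear_span A X =
     cstar_topology A closure_of ((\<lambda>V. submodule V complex_ring A) hull X)"

section \<open>The 2-adic ring C*-algebra and its diagonal\<close>

definition two_adic_relations :: "'a cstar \<Rightarrow> 'a \<Rightarrow> 'a \<Rightarrow> bool" where
  "two_adic_relations A U S2 \<longleftrightarrow>
     U \<in> carrier A \<and> S2 \<in> carrier A \<and>
     U\<^sup>\<star>\<^bsub>A\<^esub> \<otimes>\<^bsub>A\<^esub> U = \<one>\<^bsub>A\<^esub> \<and> U \<otimes>\<^bsub>A\<^esub> U\<^sup>\<star>\<^bsub>A\<^esub> = \<one>\<^bsub>A\<^esub> \<and>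
     S2\<^sup>\<star>\<^bsub>A\<^esub> \<otimes>\<^bsub>A\<^esub> S2 = \<one>\<^bsub>A\<^esub> \<and>
     S2 \<otimes>\<^bsub>A\<^esub> U = U [^]\<^bsub>A\<^esub> (2::nat) \<otimes>\<^bsub>A\<^esub> S2 \<and>
     S2 \<otimes>\<^bsub>A\<^esub> S2\<^sup>\<star>\<^bsub>A\<^esub> \<oplus>\<^bsub>A\<^esub> U \<otimes>\<^bsub>A\<^esub> S2 \<otimes>\<^bsub>A\<^esub> S2\<^sup>\<star>\<^bsub>A\<^esub> \<otimes>\<^bsub>A\<^esub> U\<^sup>\<star>\<^bsub>A\<^esub> = \<one>\<^bsub>A\<^esub>"

text \<open>\<open>A\<close> is the universal unital C*-algebra generated by \<open>U\<close> and \<open>S2\<close> subject to the relations.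
  HOL cannot quantify over all carrier types of the target \<open>B\<close> inside a formula. One type of at
  least continuum cardinality suffices: the C*-subalgebra of any \<open>B\<close> generated by \<open>V\<close> and \<open>T2\<close> is
  separable, so it has at most continuum many elements and is isomorphic to a C*-algebra carried
  by a subset of the type chosen here (which also contains all operators on \<open>l\<^sup>2(\<nat>)\<close>, extended by 0).
  Since \<open>U\<close> and \<open>S2\<close> generate \<open>A\<close>, the homomorphism \<open>\<phi>\<close> is unique on the carrier.\<close>

definition is_two_adic_ring_cstar_algebra :: "'a cstar \<Rightarrow> 'a \<Rightarrow> 'a \<Rightarrow> bool" where
  "is_two_adic_ring_cstar_algebra A U S2 \<longleftrightarrow>
     cstar_algebra A \<and> two_adic_relations A U S2 \<and>
     cstar_subalgebra A hull {U, S2} = carrier A \<and>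
     (\<forall>(B :: ((nat \<Rightarrow> complex) \<Rightarrow> nat \<Rightarrow> complex) cstar) V T2.
        cstar_algebra B \<and> two_adic_relations B V T2 \<longrightarrow>
        (\<exists>\<phi>\<in>star_hom A B. \<phi> U = V \<and> \<phi> S2 = T2))"

text \<open>The isometries \<open>S\<^sub>1 = U S\<^sub>2\<close> and \<open>S\<^sub>2\<close>; only the indices 1 and 2 are used.\<close>

definition gen_isometry :: "'a cstar \<Rightarrow> 'a \<Rightarrow> 'a \<Rightarrow> nat \<Rightarrow> 'a" where
  "gen_isometry A U S2 i = (if i = 1 then U \<otimes>\<^bsub>A\<^esub> S2 else S2)"

definition word_isometry :: "'a cstar \<Rightarrow> 'a \<Rightarrow> 'a \<Rightarrow> nat list \<Rightarrow> 'a" where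
  "word_isometry A U S2 \<mu> = foldr (\<lambda>i x. gen_isometry A U S2 i \<otimes>\<^bsub>A\<^esub> x) \<mu> \<one>\<^bsub>A\<^esub>"

definition diagonal_subalgebra :: "'a cstar \<Rightarrow> 'a \<Rightarrow> 'a \<Rightarrow> 'a set" where
  "diagonal_subalgebra A U S2 =
     closed_linear_span A
       {word_isometry A U S2 \<mu> \<otimes>\<^bsub>A\<^esub> (word_isometry A U S2 \<mu>)\<^sup>\<star>\<^bsub>A\<^esub> | \<mu>. set \<mu> \<subseteq> {1, 2}}"

end

theory Submission
  imports Defs "HOL-Real_Asymp.Real_Asymp"
begin

text \<open>
  Think of \<open>U\<close> and \<open>S\<^sub>2\<close> as induced by the maps \<open>k \<mapsto> k + 1\<close> and \<open>k \<mapsto> 2 k\<close>. The products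
  \<open>aff a m = U\<^sup>a S\<^sub>2\<^sup>m\<close> are isometries that multiply like the affine maps \<open>k \<mapsto> a + 2\<^sup>m k\<close>, their range
  projections \<open>cylinder a m\<close> span the diagonal, and the monomials \<open>(aff a m) (aff b p)\<^sup>\<star>\<close> span a dense
  *-subalgebra. Cylinders commute, so the diagonal is abelian, and it remains to show that an
  element \<open>x\<close> commuting with all cylinders is a limit of linear combinations of cylinders.

  Let \<open>y\<close> be a combination of monomials close to \<open>x\<close>. Pinching along a fine partition into
  cylinders does not change \<open>x\<close> and removes from \<open>y\<close> all monomials without fixed points in the
  2-adic integers. But a monomial with \<open>m \<noteq> p\<close> may fix a 2-adic point \<open>z\<close>, like \<open>S\<^sub>2\<close>
  fixes 0, and the corner at a cylinder containing \<open>z\<close> never vanishes. What saves the situation is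
  that the dilations and translations form an amenable group, so that the behaviour at \<open>z\<close> is already
  visible along orbits that avoid \<open>z\<close>.

  This is made explicit by the isometries \<open>spread n\<close>, normalized sums of partial isometries
  \<open>probe n l t\<close> with orthogonal ranges (\<open>spread_isometry\<close>). They have two properties.
  First, they asymptotically commute with every monomial
  (\<open>asymptotically_central_monomial_span\<close>), since conjugation by the generators only shifts the
  index \<open>t\<close> or \<open>l\<close> and changes the sum merely at its ends. Second, every monomial that is not a
  cylinder has zero corners at all probes once \<open>n\<close> is large (\<open>eventually_probe_monomial_zero\<close>);
  by \<open>monomial_corner_zero\<close> this holds because a certain nonzero integer has smaller absolute value
  than a power of 2 and so is not divisible by it.

  Since \<open>x\<close> commutes with the cylinders, its compression by \<open>spread n\<close> consists of its corners at the
  probes, and these corners are close to those of the diagonal part \<open>d\<close> of \<open>y\<close>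
  (\<open>nrm_spread_sandwich_le\<close>). As \<open>y\<close> and \<open>d\<close> almost commute with \<open>spread n\<close>, the compression
  may be undone, which shows that \<open>x\<close> is close to \<open>d\<close> (\<open>commutant_diagonal_subset\<close>).
\<close>

section \<open>Calculus in a unital C*-algebra\<close>

context cstar_algebra
begin

lemma carrier_complex_ring [simp]: "carrier complex_ring = UNIV"
  by (simp add: complex_ring_def)

lemma scale_closed [simp, intro]: "x \<in> carrier A \<Longrightarrow> c \<odot> x \<in> carrier A"
  by simp

lemma scale_add_left: "x \<in> carrier A \<Longrightarrow> (c + d) \<odot> x = c \<odot> x \<oplus> d \<odot> x"
  using lin.smult_l_distr[of c d x] by (simp add: complex_ring_def)

lemma scale_add_right:
  "x \<in> carrier A \<Longrightarrow> y \<in> carrier A \<Longrightarrow> c \<odot> (x \<oplus> y) = c \<odot> x \<oplus> c \<odot> y"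
  using lin.smult_r_distr[of c x y] by simp

lemma scale_scale: "x \<in> carrier A \<Longrightarrow> c \<odot> (d \<odot> x) = (c * d) \<odot> x"
  using lin.smult_assoc1[of c d x] by (simp add: complex_ring_def)

lemma scale_one [simp]: "x \<in> carrier A \<Longrightarrow> 1 \<odot> x = x"
  using lin.smult_one[of x] by (simp add: complex_ring_def)

lemma scale_zero_left [simp]: "x \<in> carrier A \<Longrightarrow> 0 \<odot> x = \<zero>"
  using lin.smult_l_null[of x] by (simp add: complex_ring_def)

lemma scale_zero_right [simp]: "c \<odot> \<zero> = \<zero>"
  using lin.smult_r_null[of c] by simp

lemma scale_minus_one: "x \<in> carrier A \<Longrightarrow> (-1) \<odot> x = \<ominus> x"
proof -
  assume x: "x \<in> carrier A"
  have "(-1) \<odot> x \<oplus> x = (-1 + 1) \<odot> x"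
    using x by (simp only: scale_add_left scale_one)
  then show ?thesis
    using x by (simp add: minus_equality)
qed

lemma scale_minus_right: "x \<in> carrier A \<Longrightarrow> c \<odot> (\<ominus> x) = \<ominus> (c \<odot> x)"
  by (simp add: scale_scale flip: scale_minus_one)

lemma scale_diff_right:
  "x \<in> carrier A \<Longrightarrow> y \<in> carrier A \<Longrightarrow> c \<odot> (x \<ominus> y) = c \<odot> x \<ominus> c \<odot> y"
  by (simp add: a_minus_def scale_add_right scale_minus_right)

declare star_closed [simp, intro] star_star [simp]

lemma star_zero [simp]: "\<zero>\<^sup>\<star> = \<zero>"
  using star_smult[of \<zero> 0] by simp

lemma star_minus: "x \<in> carrier A \<Longrightarrow> (\<ominus> x)\<^sup>\<star> = \<ominus> x\<^sup>\<star>"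
  using star_smult[of x "-1"] by (simp add: scale_minus_one)

lemma star_diff: "x \<in> carrier A \<Longrightarrow> y \<in> carrier A \<Longrightarrow> (x \<ominus> y)\<^sup>\<star> = x\<^sup>\<star> \<ominus> y\<^sup>\<star>"
  by (simp add: a_minus_def star_add star_minus)

lemma star_one [simp]: "\<one>\<^sup>\<star> = \<one>"
  by (metis l_one one_closed r_one star_closed star_mult star_star)

lemma nrm_zero [simp]: "nrm A \<zero> = 0"
  by (simp add: nrm_eq_0)

lemma nrm_minus: "x \<in> carrier A \<Longrightarrow> nrm A (\<ominus> x) = nrm A x"
  using nrm_smult[of x "-1"] by (simp add: scale_minus_one)

lemma nrm_diff_le: "x \<in> carrier A \<Longrightarrow> y \<in> carrier A \<Longrightarrow> nrm A (x \<ominus> y) \<le> nrm A x + nrm A y"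
  using nrm_triangle[of x "\<ominus> y"] by (simp add: a_minus_def nrm_minus)

lemma diff_eq_zero: "x \<in> carrier A \<Longrightarrow> y \<in> carrier A \<Longrightarrow> x \<ominus> y = \<zero> \<Longrightarrow> x = y"
  by (metis a_minus_def minus_equality minus_minus a_inv_closed)

text \<open>Cancelling \<open>\<parallel>x\<parallel>\<close> in \<open>\<parallel>x\<parallel>\<^sup>2 = \<parallel>x\<^sup>\<star>x\<parallel> \<le> \<parallel>x\<^sup>\<star>\<parallel> \<parallel>x\<parallel>\<close> gives one inequality; the other is the same
  for \<open>x\<^sup>\<star>\<close>.\<close>

lemma nrm_star: "x \<in> carrier A \<Longrightarrow> nrm A (x\<^sup>\<star>) = nrm A x"
proof -
  have le: "nrm A x \<le> nrm A (x\<^sup>\<star>)" if x: "x \<in> carrier A" for x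
  proof (cases "nrm A x = 0")
    case False
    then have "0 < nrm A x"
      using nrm_nonneg[OF x] by simp
    moreover have "nrm A x * nrm A x \<le> nrm A (x\<^sup>\<star>) * nrm A x"
      using cstar_identity[OF x] nrm_mult[of "x\<^sup>\<star>" x] x by (simp add: power2_eq_square)
    ultimately show ?thesis
      by simp
  qed (simp add: nrm_nonneg x)
  show "x \<in> carrier A \<Longrightarrow> nrm A (x\<^sup>\<star>) = nrm A x"
    using le[of x] le[of "x\<^sup>\<star>"] by simp
qed

lemma nrm_one_le: "nrm A \<one> \<le> 1"
proof -
  have "nrm A \<one> = (nrm A \<one>)\<^sup>2"
    using cstar_identity[of \<one>] by simp
  then have "nrm A \<one> * (nrm A \<one> - 1) = 0"
    by (simp add: power2_eq_square algebra_simps)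
  then show ?thesis
    by auto
qed

lemma nrm_isometry_le:
  assumes "x \<in> carrier A" and "x\<^sup>\<star> \<otimes> x = \<one>"
  shows "nrm A x \<le> 1"
proof -
  have "(nrm A x)\<^sup>2 \<le> 1"
    using cstar_identity[OF assms(1)] assms(2) nrm_one_le by simp
  then show ?thesis
    using abs_le_square_iff[of "nrm A x" 1] by simp
qed

lemma nrm_mult_le_left:
  assumes "x \<in> carrier A" "y \<in> carrier A" "nrm A x \<le> 1"
  shows "nrm A (x \<otimes> y) \<le> nrm A y"
  using nrm_mult[of x y] mult_right_mono[of "nrm A x" 1 "nrm A y"] nrm_nonneg[of y] assms by simp

lemma nrm_mult_le_right:
  assumes "x \<in> carrier A" "y \<in> carrier A" "nrm A y \<le> 1"
  shows "nrm A (x \<otimes> y) \<le> nrm A x"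
  using nrm_mult[of x y] mult_left_mono[of "nrm A y" 1 "nrm A x"] nrm_nonneg[of x] assms by simp

lemma star_finsum:
  assumes "finite I" and "\<And>i. i \<in> I \<Longrightarrow> h i \<in> carrier A"
  shows "(finsum A h I)\<^sup>\<star> = (\<Oplus>i\<in>I. (h i)\<^sup>\<star>)"
  using assms by (induction I rule: finite_induct) (simp_all add: Pi_def star_add)

section \<open>Linear spans and their closures\<close>

text \<open>The inductive form of the linear span turns every statement about its elements into four small
  cases.\<close>

inductive_set lspan :: "'a set \<Rightarrow> 'a set" for X where
  lspan_zero: "\<zero> \<in> lspan X"
| lspan_incl: "x \<in> X \<Longrightarrow> x \<in> lspan X"
| lspan_add: "x \<in> lspan X \<Longrightarrow> y \<in> lspan X \<Longrightarrow> x \<oplus> y \<in> lspan X"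
| lspan_scale: "x \<in> lspan X \<Longrightarrow> c \<odot> x \<in> lspan X"

lemma lspan_closed:
  assumes "x \<in> lspan X" "X \<subseteq> carrier A"
  shows "x \<in> carrier A"
  using assms by (induction rule: lspan.induct) auto

lemma submodule_lspan:
  assumes "X \<subseteq> carrier A"
  shows "submodule (lspan X) complex_ring A"
proof (rule lin.submoduleI)
  show "\<ominus> a \<in> lspan X" if "a \<in> lspan X" for a
    using lspan_scale[OF that, of "-1"] lspan_closed[OF that assms] by (simp add: scale_minus_one)
qed (use lspan_closed assms in \<open>auto intro: lspan.intros\<close>)

lemma hull_eq_lspan:
  assumes "X \<subseteq> carrier A"
  shows "(\<lambda>V. submodule V complex_ring A) hull X = lspan X"
proof (rule hull_unique)
  fix V assume V: "X \<subseteq> V" "submodule V complex_ring A"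
  interpret V: submodule V complex_ring A
    by (rule V(2))
  have "x \<in> V" if "x \<in> lspan X" for x
    using that
  proof (induction rule: lspan.induct)
    case lspan_zero
    show ?case using V.one_closed by simp
  next
    case (lspan_add x y)
    then show ?case using V.m_closed[of x y] by simp
  qed (use V(1) in auto)
  then show "lspan X \<subseteq> V" by blast
qed (use assms in \<open>auto intro: lspan.intros submodule_lspan\<close>)

lemma closed_linear_span_iff:
  assumes X: "X \<subseteq> carrier A"
  shows "x \<in> closed_linear_span A X \<longleftrightarrow>
     x \<in> carrier A \<and> (\<forall>\<epsilon>>0. \<exists>y\<in>lspan X. nrm A (x \<ominus> y) < \<epsilon>)"
proof -
  interpret M: Metric_space "carrier A" "cstar_dist A"
    by (rule Metric_space_cstar_dist)
  show ?thesis
    unfolding closed_linear_span_def hull_eq_lspan[OF X] M.metric_closure_of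
    using lspan_closed[OF _ X] by (fastforce simp: cstar_dist_def)
qed

lemma lspan_subset_closed_linear_span:
  "X \<subseteq> carrier A \<Longrightarrow> x \<in> lspan X \<Longrightarrow> x \<in> closed_linear_span A X"
  by (auto simp: closed_linear_span_iff lspan_closed a_minus_def r_neg intro!: bexI[of _ x])

lemma lspan_star:
  assumes "x \<in> lspan X" and X: "X \<subseteq> carrier A" and "\<And>x. x \<in> X \<Longrightarrow> x\<^sup>\<star> \<in> lspan X"
  shows "x\<^sup>\<star> \<in> lspan X"
  using assms(1)
proof (induction rule: lspan.induct)
  case (lspan_add x y)
  then show ?case
    using lspan_closed[OF _ X] by (simp add: star_add lspan.lspan_add)
next
  case (lspan_scale x c)
  then show ?case
    using lspan_closed[OF _ X] by (simp add: star_smult lspan.lspan_scale)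
qed (use assms(3) in \<open>auto intro: lspan.intros\<close>)

lemma lspan_mult:
  assumes "x \<in> lspan X" "y \<in> lspan X" and X: "X \<subseteq> carrier A"
    and mult: "\<And>x y. x \<in> X \<Longrightarrow> y \<in> X \<Longrightarrow> x \<otimes> y \<in> lspan X"
  shows "x \<otimes> y \<in> lspan X"
proof -
  note cl = lspan_closed[OF _ X]
  have 1: "a \<otimes> y \<in> lspan X" if a: "a \<in> X" for a
    using assms(2)
  proof (induction rule: lspan.induct)
    case (lspan_add x y)
    then show ?case
      using cl a X by (simp add: r_distr lspan.lspan_add subset_iff)
  next
    case (lspan_scale x c)
    then show ?case
      using cl a X by (simp add: smult_mult_right lspan.lspan_scale subset_iff)
  qed (use a X mult in \<open>auto simp: subset_iff intro: lspan.intros\<close>)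
  show ?thesis
    using assms(1)
  proof (induction rule: lspan.induct)
    case (lspan_add x z)
    then show ?case
      using cl assms(2) by (simp add: l_distr lspan.lspan_add)
  next
    case (lspan_scale x c)
    then show ?case
      using cl assms(2) by (simp add: smult_mult_left lspan.lspan_scale)
  qed (use cl assms(2) 1 in \<open>auto intro: lspan.intros\<close>)
qed

lemma mult_diff_mult:
  assumes "x \<in> carrier A" "y \<in> carrier A" "x' \<in> carrier A" "y' \<in> carrier A"
  shows "x \<otimes> y \<ominus> x' \<otimes> y' = (x \<ominus> x') \<otimes> y \<oplus> x' \<otimes> (y \<ominus> y')"
  using assms by algebra

lemma add_diff_add:
  assumes "x \<in> carrier A" "y \<in> carrier A" "x' \<in> carrier A" "y' \<in> carrier A"
  shows "(x \<oplus> y) \<ominus> (x' \<oplus> y') = (x \<ominus> x') \<oplus> (y \<ominus> y')"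
  using assms by algebra

lemma diff_add_diff:
  assumes "x \<in> carrier A" "y \<in> carrier A" "z \<in> carrier A"
  shows "x \<ominus> z = (x \<ominus> y) \<oplus> (y \<ominus> z)"
  using assms by algebra

lemma nrm_diff_triangle:
  assumes "x \<in> carrier A" "y \<in> carrier A" "z \<in> carrier A"
  shows "nrm A (x \<ominus> z) \<le> nrm A (x \<ominus> y) + nrm A (y \<ominus> z)"
  using diff_add_diff[OF assms] nrm_triangle[of "x \<ominus> y" "y \<ominus> z"] assms by simp


text \<open>This is used twice: for the range projections, where it makes the diagonal a C*-subalgebra, and
  for the monomials in the generators, where it shows that they span a dense subspace.\<close>

lemma cstar_subalgebra_closed_linear_span:
  assumes X: "X \<subseteq> carrier A"
    and mult: "\<And>x y. x \<in> X \<Longrightarrow> y \<in> X \<Longrightarrow> x \<otimes> y \<in> lspan X"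
    and star: "\<And>x. x \<in> X \<Longrightarrow> x\<^sup>\<star> \<in> lspan X"
  shows "cstar_subalgebra A (closed_linear_span A X)" (is "cstar_subalgebra A ?C")
proof -
  note cl = lspan_closed[OF _ X] and iff = closed_linear_span_iff[OF X]
  have scale: "c \<odot> x \<in> ?C" if x: "x \<in> ?C" for c x
  proof -
    have "\<exists>y\<in>lspan X. nrm A (c \<odot> x \<ominus> y) < \<epsilon>" if "\<epsilon> > 0" for \<epsilon>
    proof -
      have "\<epsilon> / (cmod c + 1) > 0"
        using that by (simp add: add_nonneg_pos)
      then obtain y where y: "y \<in> lspan X" "nrm A (x \<ominus> y) < \<epsilon> / (cmod c + 1)"
        using x unfolding iff by blast
      have "nrm A (c \<odot> x \<ominus> c \<odot> y) = cmod c * nrm A (x \<ominus> y)"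
        using x y(1) cl by (simp add: iff nrm_smult flip: scale_diff_right)
      also have "\<dots> \<le> (cmod c + 1) * nrm A (x \<ominus> y)"
        using x y(1) cl by (simp add: iff nrm_nonneg mult_right_mono)
      also have "\<dots> < \<epsilon>"
        using y(2) by (simp add: pos_less_divide_eq add_nonneg_pos mult.commute)
      finally show ?thesis
        using y(1) lspan_scale by blast
    qed
    then show ?thesis
      using x by (simp add: iff)
  qed
  have add: "x \<oplus> y \<in> ?C" if x: "x \<in> ?C" and y: "y \<in> ?C" for x y
  proof -
    have "\<exists>z\<in>lspan X. nrm A (x \<oplus> y \<ominus> z) < \<epsilon>" if \<epsilon>: "\<epsilon> > 0" for \<epsilon>
    proof -
      obtain x' where x': "x' \<in> lspan X" "nrm A (x \<ominus> x') < \<epsilon> / 2"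
        using x \<epsilon> unfolding iff by (meson half_gt_zero)
      obtain y' where y': "y' \<in> lspan X" "nrm A (y \<ominus> y') < \<epsilon> / 2"
        using y \<epsilon> unfolding iff by (meson half_gt_zero)
      have "nrm A (x \<oplus> y \<ominus> (x' \<oplus> y')) \<le> nrm A (x \<ominus> x') + nrm A (y \<ominus> y')"
        using x y x'(1) y'(1) cl by (simp add: iff add_diff_add nrm_triangle)
      then have "nrm A (x \<oplus> y \<ominus> (x' \<oplus> y')) < \<epsilon>"
        using x'(2) y'(2) by simp
      then show ?thesis
        using lspan_add[OF x'(1) y'(1)] by blast
    qed
    then show ?thesis
      using x y by (simp add: iff)
  qed
  have prod: "x \<otimes> y \<in> ?C" if x: "x \<in> ?C" and y: "y \<in> ?C" for x y
  proof -
    have xc: "x \<in> carrier A" and yc: "y \<in> carrier A"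
      using x y by (simp_all add: iff)
    have "\<exists>z\<in>lspan X. nrm A (x \<otimes> y \<ominus> z) < \<epsilon>" if \<epsilon>: "\<epsilon> > 0" for \<epsilon>
    proof -
      define \<delta> where "\<delta> = \<epsilon> / (2 * (nrm A y + 1))"
      have \<delta>: "\<delta> > 0"
        using \<epsilon> nrm_nonneg[OF yc] by (simp add: \<delta>_def add_nonneg_pos)
      obtain x' where x': "x' \<in> lspan X" "nrm A (x \<ominus> x') < \<delta>"
        using x \<delta> unfolding iff by blast
      define \<eta> where "\<eta> = \<epsilon> / (2 * (nrm A x' + 1))"
      have \<eta>: "\<eta> > 0"
        using \<epsilon> nrm_nonneg[OF cl[OF x'(1)]] by (simp add: \<eta>_def add_nonneg_pos)
      obtain y' where y': "y' \<in> lspan X" "nrm A (y \<ominus> y') < \<eta>"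
        using y \<eta> unfolding iff by blast
      note c = xc yc cl[OF x'(1)] cl[OF y'(1)]
      have "nrm A (x \<otimes> y \<ominus> x' \<otimes> y') \<le> nrm A ((x \<ominus> x') \<otimes> y) + nrm A (x' \<otimes> (y \<ominus> y'))"
        using c by (simp add: mult_diff_mult nrm_triangle)
      also have "\<dots> \<le> nrm A (x \<ominus> x') * nrm A y + nrm A x' * nrm A (y \<ominus> y')"
        using c by (intro add_mono nrm_mult) auto
      also have "nrm A (x \<ominus> x') * nrm A y \<le> \<delta> * (nrm A y + 1)"
        using x'(2) \<delta> nrm_nonneg[OF yc] nrm_nonneg[of "x \<ominus> x'"] c by (intro mult_mono) auto
      also have "\<dots> = \<epsilon> / 2"
        using nrm_nonneg[OF yc] by (simp add: \<delta>_def field_simps)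
      also have "nrm A x' * nrm A (y \<ominus> y') < (nrm A x' + 1) * \<eta>"
        using y'(2) \<eta> nrm_nonneg[OF c(3)] nrm_nonneg[of "y \<ominus> y'"] c
        by (intro mult_less_le_imp_less mult_strict_mono') auto
      also have "\<dots> = \<epsilon> / 2"
        using nrm_nonneg[OF c(3)] by (simp add: \<eta>_def field_simps)
      finally have "nrm A (x \<otimes> y \<ominus> x' \<otimes> y') < \<epsilon>"
        by simp
      then show ?thesis
        using lspan_mult[OF x'(1) y'(1) X mult] by blast
    qed
    then show ?thesis
      using xc yc by (simp add: iff)
  qed
  have star: "x\<^sup>\<star> \<in> ?C" if x: "x \<in> ?C" for x
  proof -
    have "\<exists>y\<in>lspan X. nrm A (x\<^sup>\<star> \<ominus> y) < \<epsilon>" if \<epsilon>: "\<epsilon> > 0" for \<epsilon>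
    proof -
      obtain y where y: "y \<in> lspan X" "nrm A (x \<ominus> y) < \<epsilon>"
        using x \<epsilon> unfolding iff by blast
      have "nrm A (x\<^sup>\<star> \<ominus> y\<^sup>\<star>) < \<epsilon>"
        using x y cl nrm_star[of "x \<ominus> y"] by (simp add: iff star_diff)
      then show ?thesis
        using lspan_star[OF y(1) X star] by blast
    qed
    then show ?thesis
      using x by (simp add: iff)
  qed
  have "submodule ?C complex_ring A"
  proof (rule lin.submoduleI)
    show "\<ominus> x \<in> ?C" if "x \<in> ?C" for x
      using scale[OF that, of "-1"] that by (simp add: iff scale_minus_one)
    show "\<zero> \<in> ?C"
      using lspan_subset_closed_linear_span[OF X lspan_zero] .
  qed (use scale add in \<open>auto simp: iff\<close>)
  then show ?thesis
    using prod star unfolding cstar_subalgebra_def closed_linear_span_def by simp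
qed

lemma commute_add:
  assumes "x \<in> carrier A" "y \<in> carrier A" "b \<in> carrier A"
    and "x \<otimes> b = b \<otimes> x" "y \<otimes> b = b \<otimes> y"
  shows "(x \<oplus> y) \<otimes> b = b \<otimes> (x \<oplus> y)"
  using assms by (simp add: l_distr r_distr)

lemma commute_scale:
  assumes "x \<in> carrier A" "b \<in> carrier A" and "x \<otimes> b = b \<otimes> x"
  shows "(c \<odot> x) \<otimes> b = b \<otimes> (c \<odot> x)"
  using assms by (simp add: smult_mult_left smult_mult_right)

lemma lspan_commute:
  assumes "x \<in> lspan X" and X: "X \<subseteq> carrier A" and b: "b \<in> carrier A"
    and "\<And>x. x \<in> X \<Longrightarrow> x \<otimes> b = b \<otimes> x"
  shows "x \<otimes> b = b \<otimes> x"
  using assms(1)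
  by (induction rule: lspan.induct)
    (use assms(4) b lspan_closed[OF _ X] in \<open>auto intro: commute_add commute_scale\<close>)

text \<open>The commutant of \<open>b\<close> is a closed subspace: for \<open>y\<close> in it,
  \<open>\<parallel>xb - bx\<parallel> \<le> 2 \<parallel>b\<parallel> \<parallel>x - y\<parallel>\<close>.\<close>

lemma closed_linear_span_commute:
  assumes x: "x \<in> closed_linear_span A X" and X: "X \<subseteq> carrier A" and b: "b \<in> carrier A"
    and comm: "\<And>x. x \<in> X \<Longrightarrow> x \<otimes> b = b \<otimes> x"
  shows "x \<otimes> b = b \<otimes> x"
proof -
  have xc: "x \<in> carrier A"
    using x by (simp add: closed_linear_span_iff[OF X])
  have "nrm A (x \<otimes> b \<ominus> b \<otimes> x) \<le> 0 + \<epsilon>" if "\<epsilon> > 0" for \<epsilon>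
  proof -
    have "\<epsilon> / (2 * (nrm A b + 1)) > 0"
      using that nrm_nonneg[OF b] by (simp add: add_nonneg_pos)
    then obtain y where y: "y \<in> lspan X" "nrm A (x \<ominus> y) < \<epsilon> / (2 * (nrm A b + 1))"
      using x unfolding closed_linear_span_iff[OF X] by blast
    have yc: "y \<in> carrier A" and yb: "y \<otimes> b = b \<otimes> y"
      using lspan_closed[OF y(1) X] lspan_commute[OF y(1) X b comm] by auto
    have "x \<otimes> b \<ominus> b \<otimes> x = (x \<ominus> y) \<otimes> b \<ominus> b \<otimes> (x \<ominus> y) \<oplus> (y \<otimes> b \<ominus> b \<otimes> y)"
      using xc yc b by algebra
    also have "\<dots> = (x \<ominus> y) \<otimes> b \<ominus> b \<otimes> (x \<ominus> y)"
      using xc yc b by (simp add: yb a_minus_def r_neg)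
    finally have "nrm A (x \<otimes> b \<ominus> b \<otimes> x) \<le> nrm A ((x \<ominus> y) \<otimes> b) + nrm A (b \<otimes> (x \<ominus> y))"
      using xc yc b by (simp add: nrm_diff_le)
    also have "\<dots> \<le> nrm A (x \<ominus> y) * nrm A b + nrm A b * nrm A (x \<ominus> y)"
      using xc yc b by (intro add_mono nrm_mult) auto
    also have "\<dots> \<le> nrm A (x \<ominus> y) * (2 * (nrm A b + 1))"
      using nrm_nonneg[of "x \<ominus> y"] xc yc by (simp add: algebra_simps)
    also have "\<dots> \<le> \<epsilon>"
      using y(2) nrm_nonneg[OF b] by (simp add: pos_less_divide_eq add_nonneg_pos less_imp_le)
    finally show ?thesis
      by simp
  qed
  then have "nrm A (x \<otimes> b \<ominus> b \<otimes> x) \<le> 0"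
    by (rule field_le_epsilon)
  then have "x \<otimes> b \<ominus> b \<otimes> x = \<zero>"
    using nrm_nonneg[of "x \<otimes> b \<ominus> b \<otimes> x"] nrm_eq_0[of "x \<otimes> b \<ominus> b \<otimes> x"] xc b by simp
  then show ?thesis
    using xc b by (simp add: diff_eq_zero)
qed


section \<open>Finite sums and pinching\<close>

lemma finsum_double:
  assumes "\<And>t. f t \<in> carrier A"
  shows "finsum A f {..<2 * N} = (\<Oplus>t\<in>{..<N}. f (2 * t) \<oplus> f (Suc (2 * t)))"
proof (induction N)
  case (Suc N)
  have "{..<2 * Suc N} = insert (Suc (2 * N)) (insert (2 * N) {..<2 * N})"
    by auto
  then show ?case
    using assms Suc by (simp add: lessThan_Suc a_ac Pi_def)
qed simp

lemma finsum_lessThan_Suc: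
  assumes "\<And>t. f t \<in> carrier A"
  shows "finsum A f {..<Suc N} = f N \<oplus> finsum A f {..<N}"
  using assms by (simp add: lessThan_Suc Pi_def)

lemma commutator_add:
  assumes "b \<in> carrier A" "x \<in> carrier A" "y \<in> carrier A"
  shows "b \<otimes> (x \<oplus> y) \<ominus> (x \<oplus> y) \<otimes> b = (b \<otimes> x \<ominus> x \<otimes> b) \<oplus> (b \<otimes> y \<ominus> y \<otimes> b)"
  using assms by algebra

text \<open>If \<open>b\<close> carries each \<open>h i\<close> to the next one, it almost commutes with a long sum of them, because only
  the two ends of the sum survive in the commutator. The backward version serves the adjoints of the
  generators.\<close>

lemma telescope_forward:
  assumes b: "b \<in> carrier A" and h: "\<And>i. h i \<in> carrier A"
    and shift: "\<And>i. i < N \<Longrightarrow> b \<otimes> h i = h (Suc i) \<otimes> b"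
  shows "b \<otimes> finsum A h {..<N} \<ominus> finsum A h {..<N} \<otimes> b = h N \<otimes> b \<ominus> h 0 \<otimes> b"
  using shift
proof (induction N)
  case 0
  then show ?case using b h[of 0] by (simp add: a_minus_def r_neg)
next
  case (Suc N)
  let ?s = "finsum A h {..<N}"
  have s: "?s \<in> carrier A"
    using h by (simp add: Pi_def)
  have "b \<otimes> finsum A h {..<Suc N} \<ominus> finsum A h {..<Suc N} \<otimes> b
      = b \<otimes> h N \<ominus> h N \<otimes> b \<oplus> (b \<otimes> ?s \<ominus> ?s \<otimes> b)"
    using commutator_add[OF b h s] by (simp add: finsum_lessThan_Suc h)
  also have "b \<otimes> ?s \<ominus> ?s \<otimes> b = h N \<otimes> b \<ominus> h 0 \<otimes> b"
    using Suc by simp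
  also have "b \<otimes> h N = h (Suc N) \<otimes> b"
    using Suc.prems by simp
  also have "h (Suc N) \<otimes> b \<ominus> h N \<otimes> b \<oplus> (h N \<otimes> b \<ominus> h 0 \<otimes> b) = h (Suc N) \<otimes> b \<ominus> h 0 \<otimes> b"
    using diff_add_diff[of "h (Suc N) \<otimes> b" "h N \<otimes> b" "h 0 \<otimes> b"] b h by simp
  finally show ?case .
qed

lemma telescope_backward:
  assumes b: "b \<in> carrier A" and h: "\<And>i. h i \<in> carrier A"
    and shift: "\<And>i. i < N \<Longrightarrow> b \<otimes> h (Suc i) = h i \<otimes> b"
  shows "b \<otimes> finsum A h {..<N} \<ominus> finsum A h {..<N} \<otimes> b = b \<otimes> h 0 \<ominus> b \<otimes> h N"
  using shift
proof (induction N)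
  case 0
  then show ?case using b h[of 0] by (simp add: a_minus_def r_neg)
next
  case (Suc N)
  let ?s = "finsum A h {..<N}"
  have s: "?s \<in> carrier A"
    using h by (simp add: Pi_def)
  have "b \<otimes> finsum A h {..<Suc N} \<ominus> finsum A h {..<Suc N} \<otimes> b
      = (b \<otimes> ?s \<ominus> ?s \<otimes> b) \<oplus> (b \<otimes> h N \<ominus> h N \<otimes> b)"
    using commutator_add[OF b s h[of N]] s h by (simp add: finsum_lessThan_Suc a_comm)
  also have "b \<otimes> ?s \<ominus> ?s \<otimes> b = b \<otimes> h 0 \<ominus> b \<otimes> h N"
    using Suc by simp
  also have "h N \<otimes> b = b \<otimes> h (Suc N)"
    using Suc.prems by simp
  also have "b \<otimes> h 0 \<ominus> b \<otimes> h N \<oplus> (b \<otimes> h N \<ominus> b \<otimes> h (Suc N)) = b \<otimes> h 0 \<ominus> b \<otimes> h (Suc N)"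
    using diff_add_diff[of "b \<otimes> h 0" "b \<otimes> h N" "b \<otimes> h (Suc N)"] b h by simp
  finally show ?case .
qed

lemma sandwich_finsum_zero:
  assumes fin: "finite I" "finite J" and a: "a \<in> carrier A"
    and g: "\<And>i. i \<in> I \<Longrightarrow> g i \<in> carrier A" and h: "\<And>j. j \<in> J \<Longrightarrow> h j \<in> carrier A"
    and zero: "\<And>i j. i \<in> I \<Longrightarrow> j \<in> J \<Longrightarrow> (g i)\<^sup>\<star> \<otimes> a \<otimes> h j = \<zero>"
  shows "(finsum A g I)\<^sup>\<star> \<otimes> a \<otimes> finsum A h J = \<zero>"
proof -
  have "(g i)\<^sup>\<star> \<otimes> a \<otimes> finsum A h J = \<zero>" if "i \<in> I" for i
    using that fin a g h zero by (simp add: finsum_rdistr Pi_def add.finprod_one_eqI)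
  moreover have "finsum A h J \<in> carrier A"
    using h by (simp add: Pi_def)
  ultimately show ?thesis
    using fin a g by (simp add: star_finsum finsum_ldistr Pi_def add.finprod_one_eqI)
qed

lemma sandwich_finsum:
  assumes fin: "finite I" and a: "a \<in> carrier A"
    and h: "\<And>i. i \<in> I \<Longrightarrow> h i \<in> carrier A"
    and zero: "\<And>i j. i \<in> I \<Longrightarrow> j \<in> I \<Longrightarrow> i \<noteq> j \<Longrightarrow> (h i)\<^sup>\<star> \<otimes> a \<otimes> h j = \<zero>"
  shows "(finsum A h I)\<^sup>\<star> \<otimes> a \<otimes> finsum A h I = (\<Oplus>i\<in>I. (h i)\<^sup>\<star> \<otimes> a \<otimes> h i)"
  using fin h zero
proof (induction I rule: finite_induct)
  case (insert i I)
  let ?s = "finsum A h I"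
  have c: "h i \<in> carrier A" "?s \<in> carrier A"
    using insert by (auto simp: Pi_def)
  have hs: "(h i)\<^sup>\<star> \<otimes> a \<otimes> ?s = \<zero>"
    using sandwich_finsum_zero[of "{i}" I a h h] insert a by (auto simp: finsum_singleton Pi_def)
  have sh: "?s\<^sup>\<star> \<otimes> a \<otimes> h i = \<zero>"
    using sandwich_finsum_zero[of I "{i}" a h h] insert a by (auto simp: finsum_singleton Pi_def)
  have "(h i \<oplus> ?s)\<^sup>\<star> \<otimes> a \<otimes> (h i \<oplus> ?s)
      = ((h i)\<^sup>\<star> \<otimes> a \<otimes> h i \<oplus> (h i)\<^sup>\<star> \<otimes> a \<otimes> ?s) \<oplus> (?s\<^sup>\<star> \<otimes> a \<otimes> h i \<oplus> ?s\<^sup>\<star> \<otimes> a \<otimes> ?s)"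
    using c a by (simp add: star_add l_distr r_distr a_ac)
  also have "\<dots> = (h i)\<^sup>\<star> \<otimes> a \<otimes> h i \<oplus> ?s\<^sup>\<star> \<otimes> a \<otimes> ?s"
    using c a by (simp add: hs sh)
  finally show ?case
    using insert a by (simp add: Pi_def)
qed (use a in simp)

lemma sandwich_finsum_finsum:
  assumes fin: "finite I" "\<And>i. finite (J i)" and a: "a \<in> carrier A"
    and g: "\<And>i j. g i j \<in> carrier A"
    and zero: "\<And>i j i' j'. i \<in> I \<Longrightarrow> i' \<in> I \<Longrightarrow> j \<in> J i \<Longrightarrow> j' \<in> J i' \<Longrightarrow> (i, j) \<noteq> (i', j') \<Longrightarrow>
      (g i j)\<^sup>\<star> \<otimes> a \<otimes> g i' j' = \<zero>"
  shows "(\<Oplus>i\<in>I. \<Oplus>j\<in>J i. g i j)\<^sup>\<star> \<otimes> a \<otimes> (\<Oplus>i\<in>I. \<Oplus>j\<in>J i. g i j) =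
     (\<Oplus>i\<in>I. \<Oplus>j\<in>J i. (g i j)\<^sup>\<star> \<otimes> a \<otimes> g i j)"
proof -
  have "(\<Oplus>i\<in>I. \<Oplus>j\<in>J i. g i j)\<^sup>\<star> \<otimes> a \<otimes> (\<Oplus>i\<in>I. \<Oplus>j\<in>J i. g i j)
      = (\<Oplus>i\<in>I. (\<Oplus>j\<in>J i. g i j)\<^sup>\<star> \<otimes> a \<otimes> (\<Oplus>j\<in>J i. g i j))"
    using fin a g zero by (intro sandwich_finsum sandwich_finsum_zero) (auto simp: Pi_def)
  also have "\<dots> = (\<Oplus>i\<in>I. \<Oplus>j\<in>J i. (g i j)\<^sup>\<star> \<otimes> a \<otimes> g i j)"
    using fin a g zero by (intro finsum_cong' refl sandwich_finsum) (auto simp: Pi_def)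
  finally show ?thesis .
qed

text \<open>With the self-adjoint unitary \<open>u = p - (1 - p)\<close>, twice the pinching of \<open>a\<close> is \<open>a + u a u\<close>.\<close>

lemma nrm_pinching_le:
  assumes p: "p \<in> carrier A" "p\<^sup>\<star> = p" "p \<otimes> p = p" and a: "a \<in> carrier A"
  shows "nrm A (p \<otimes> a \<otimes> p \<oplus> (\<one> \<ominus> p) \<otimes> a \<otimes> (\<one> \<ominus> p)) \<le> nrm A a"
proof -
  define f where "f = \<one> \<ominus> p"
  define b where "b = p \<otimes> a \<otimes> p \<oplus> f \<otimes> a \<otimes> f"
  define u where "u = p \<ominus> f"
  have f: "f \<in> carrier A" and fs: "f\<^sup>\<star> = f"
    using p by (simp_all add: f_def star_diff)
  have pf: "p \<otimes> f = \<zero>"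
    using p by (simp add: f_def a_minus_def r_distr r_minus r_neg)
  have fp: "f \<otimes> p = \<zero>"
    using p by (simp add: f_def a_minus_def l_distr l_minus r_neg)
  have one: "p \<oplus> f = \<one>"
    unfolding f_def using p by algebra
  have ff: "f \<otimes> f = f"
  proof -
    have "f \<otimes> f = (p \<oplus> f) \<otimes> f"
      using p f by (simp add: l_distr pf)
    then show ?thesis
      using f by (simp add: one)
  qed
  have u: "u \<in> carrier A"
    using p f by (simp add: u_def)
  have "u\<^sup>\<star> \<otimes> u = (p \<otimes> p \<ominus> p \<otimes> f) \<ominus> (f \<otimes> p \<ominus> f \<otimes> f)"
    unfolding u_def using p f fs by (simp add: star_diff) algebra
  also have "\<dots> = p \<oplus> f"
    using p f by (simp add: pf fp ff a_minus_def)
  finally have nu: "nrm A u \<le> 1"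
    using u by (simp add: one nrm_isometry_le)
  have b: "b \<in> carrier A"
    using p f a by (simp add: b_def)
  have "a \<oplus> u \<otimes> a \<otimes> u = (p \<oplus> f) \<otimes> a \<otimes> (p \<oplus> f) \<oplus> u \<otimes> a \<otimes> u"
    using a by (simp add: one)
  also have "\<dots> = b \<oplus> b"
    unfolding u_def b_def using p f a by algebra
  also have "\<dots> = (1 + 1) \<odot> b"
    using b by (simp only: scale_add_left scale_one)
  finally have "2 * nrm A b = nrm A (a \<oplus> u \<otimes> a \<otimes> u)"
    using b by (simp add: nrm_smult)
  also have "\<dots> \<le> nrm A a + nrm A (u \<otimes> a \<otimes> u)"
    using a u by (simp add: nrm_triangle)
  also have "nrm A (u \<otimes> a \<otimes> u) \<le> nrm A a"
    using nrm_mult_le_right[of "u \<otimes> a" u] nrm_mult_le_left[of u a] a u nu by simp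
  finally show ?thesis
    by (simp add: b_def f_def)
qed

text \<open>Pinching along one projection after the other yields an element of no larger norm that is block
  diagonal on the chosen projections. The last conjunct keeps the blocks that are still to be
  treated unchanged, so that the induction goes through.\<close>

lemma pinching_exists:
  assumes "finite I" "I \<subseteq> J"
    and q: "\<And>j. j \<in> J \<Longrightarrow> q j \<in> carrier A" "\<And>j. j \<in> J \<Longrightarrow> (q j)\<^sup>\<star> = q j"
      "\<And>j. j \<in> J \<Longrightarrow> q j \<otimes> q j = q j"
    and orth: "\<And>i j. i \<in> J \<Longrightarrow> j \<in> J \<Longrightarrow> i \<noteq> j \<Longrightarrow> q i \<otimes> q j = \<zero>"
    and a: "a \<in> carrier A"
  shows "\<exists>c\<in>carrier A. nrm A c \<le> nrm A a \<and> (\<forall>i\<in>I. q i \<otimes> c = q i \<otimes> a \<otimes> q i) \<and>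
     (\<forall>j\<in>J. q j \<otimes> c \<otimes> q j = q j \<otimes> a \<otimes> q j)"
  using assms(1,2)
proof (induction I rule: finite_induct)
  case empty
  then show ?case using a by auto
next
  case (insert k I)
  then obtain c where c: "c \<in> carrier A" "nrm A c \<le> nrm A a"
    and cI: "\<And>i. i \<in> I \<Longrightarrow> q i \<otimes> c = q i \<otimes> a \<otimes> q i"
    and cJ: "\<And>j. j \<in> J \<Longrightarrow> q j \<otimes> c \<otimes> q j = q j \<otimes> a \<otimes> q j"
    by auto
  have k: "k \<in> J" and IJ: "I \<subseteq> J"
    using insert.prems by auto
  note qk = q[OF k]
  define f where "f = \<one> \<ominus> q k"
  define d where "d = q k \<otimes> c \<otimes> q k \<oplus> f \<otimes> c \<otimes> f"
  have f: "f \<in> carrier A"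
    using qk by (simp add: f_def)
  have d: "d \<in> carrier A"
    using qk f c by (simp add: d_def)
  have qf: "q j \<otimes> f = q j" and fq: "f \<otimes> q j = q j" if "j \<in> J" "j \<noteq> k" for j
    using that q[OF that(1)] qk orth[OF k that(1)] orth[OF that(1) k]
    by (simp_all add: f_def a_minus_def r_distr l_distr r_minus l_minus)
  have kf: "q k \<otimes> f = \<zero>" and fk: "f \<otimes> q k = \<zero>"
    using qk by (simp_all add: f_def a_minus_def r_distr l_distr r_minus l_minus r_neg)
  have qd: "q j \<otimes> d = q j \<otimes> c \<otimes> f" if j: "j \<in> J" "j \<noteq> k" for j
  proof -
    have "q j \<otimes> d = (q j \<otimes> q k) \<otimes> (c \<otimes> q k) \<oplus> (q j \<otimes> f) \<otimes> (c \<otimes> f)"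
      using q[OF j(1)] qk c f by (simp add: d_def r_distr m_assoc)
    then show ?thesis
      using q[OF j(1)] qk c f j k by (simp add: orth qf m_assoc)
  qed
  have kd: "q k \<otimes> d = q k \<otimes> a \<otimes> q k"
  proof -
    have "q k \<otimes> d = (q k \<otimes> q k) \<otimes> (c \<otimes> q k) \<oplus> (q k \<otimes> f) \<otimes> (c \<otimes> f)"
      using qk(1) c(1) f by (simp add: d_def r_distr m_assoc del: qk(3))
    also have "\<dots> = q k \<otimes> c \<otimes> q k"
      using qk(1) c(1) f by (simp add: qk(3) kf) (simp add: m_assoc)
    finally show ?thesis
      by (simp add: cJ k)
  qed
  have "q j \<otimes> d \<otimes> q j = q j \<otimes> a \<otimes> q j" if j: "j \<in> J" for j
  proof (cases "j = k")
    case True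
    then show ?thesis
      using qk a by (simp add: kd m_assoc)
  next
    case False
    then show ?thesis
      using qd[OF j False] fq[OF j False] cJ[OF j] q[OF j] f c by (simp add: m_assoc)
  qed
  moreover have "q i \<otimes> d = q i \<otimes> a \<otimes> q i" if i: "i \<in> insert k I" for i
  proof (cases "i = k")
    case False
    then have iI: "i \<in> I" and iJ: "i \<in> J"
      using i IJ by auto
    have "q i \<otimes> d = q i \<otimes> a \<otimes> (q i \<otimes> f)"
      using qd[OF iJ False] cI[OF iI] q[OF iJ] a f by (simp add: m_assoc)
    then show ?thesis
      by (simp add: qf[OF iJ False])
  qed (simp add: kd)
  moreover have "nrm A d \<le> nrm A a"
    using nrm_pinching_le[OF qk c(1)] c(2) by (simp add: d_def f_def)
  ultimately show ?case
    using d by blast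
qed

end

section \<open>The affine semigroup in a 2-adic ring algebra\<close>

locale two_adic = cstar_algebra A
  for A :: "'a cstar" (structure) and U S :: 'a +
  assumes relations: "two_adic_relations A U S"
begin

lemma U_closed [simp, intro]: "U \<in> carrier A" and S_closed [simp, intro]: "S \<in> carrier A"
  and star_U_U: "U\<^sup>\<star> \<otimes> U = \<one>" and U_star_U: "U \<otimes> U\<^sup>\<star> = \<one>" and star_S_S: "S\<^sup>\<star> \<otimes> S = \<one>"
  and S_U: "S \<otimes> U = U \<otimes> U \<otimes> S"
  and range_sum: "S \<otimes> S\<^sup>\<star> \<oplus> (U \<otimes> S) \<otimes> (U \<otimes> S)\<^sup>\<star> = \<one>"
  using relations by (auto simp: two_adic_relations_def numeral_2_eq_2 star_mult m_assoc)

definition Upow :: "int \<Rightarrow> 'a" where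
  "Upow k = (if 0 \<le> k then U [^] nat k else U\<^sup>\<star> [^] nat (- k))"

lemma Upow_closed [simp, intro]: "Upow k \<in> carrier A"
  by (simp add: Upow_def del: pow_nat)

lemma Upow_0 [simp]: "Upow 0 = \<one>"
  by (simp add: Upow_def)

lemma Upow_1 [simp]: "Upow 1 = U"
  by (simp add: Upow_def)

lemma Upow_minus_1: "Upow (- 1) = U\<^sup>\<star>"
  by (simp add: Upow_def)

lemma Upow_Suc: "Upow (k + 1) = U \<otimes> Upow k"
proof (cases "0 \<le> k")
  case True
  then show ?thesis
    using nat_pow_Suc2[of U "nat k"] by (simp add: Upow_def nat_add_distrib del: pow_nat)
next
  case False
  then have "nat (- k) = Suc (nat (- (k + 1)))"
    by simp
  then have "U \<otimes> Upow k = U \<otimes> (U\<^sup>\<star> \<otimes> U\<^sup>\<star> [^] nat (- (k + 1)))"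
    using False nat_pow_Suc2[of "U\<^sup>\<star>" "nat (- (k + 1))"] by (simp add: Upow_def del: pow_nat nat_pow_Suc)
  also have "\<dots> = U\<^sup>\<star> [^] nat (- (k + 1))"
    by (simp add: U_star_U flip: m_assoc)
  also have "\<dots> = Upow (k + 1)"
    using False by (auto simp: Upow_def simp del: pow_nat)
  finally show ?thesis by simp
qed

lemma Upow_pred: "Upow (k - 1) = U\<^sup>\<star> \<otimes> Upow k"
  using Upow_Suc[of "k - 1"] by (simp add: star_U_U flip: m_assoc)

lemma Upow_add: "Upow (j + k) = Upow j \<otimes> Upow k"
proof (induction j rule: int_induct[where k = 0])
  case (step1 j)
  then show ?case
    using Upow_Suc[of "j + k"] Upow_Suc[of j] by (simp add: add_ac m_assoc)
next
  case (step2 j)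
  then show ?case
    using Upow_pred[of "j + k"] Upow_pred[of j] by (simp add: algebra_simps m_assoc)
qed simp

lemma star_Upow: "(Upow k)\<^sup>\<star> = Upow (- k)"
proof (induction k rule: int_induct[where k = 0])
  case (step1 k)
  then show ?case
    using Upow_Suc[of k] Upow_add[of "- k" "- 1"] by (simp add: star_mult Upow_minus_1)
next
  case (step2 k)
  then show ?case
    using Upow_pred[of k] Upow_add[of "- k" 1] by (simp add: star_mult)
qed simp

lemma S_Upow: "S \<otimes> Upow k = Upow (2 * k) \<otimes> S"
proof (induction k rule: int_induct[where k = 0])
  case (step1 k)
  have "S \<otimes> Upow (k + 1) = U \<otimes> U \<otimes> (S \<otimes> Upow k)"
    by (simp add: Upow_Suc S_U flip: m_assoc)
  also have "\<dots> = Upow (2 * k + 1 + 1) \<otimes> S"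
    unfolding Upow_Suc step1 by (simp add: m_assoc)
  finally show ?case
    by (simp add: algebra_simps)
next
  case (step2 k)
  have "U \<otimes> U \<otimes> (S \<otimes> Upow (k - 1)) = S \<otimes> Upow (k - 1 + 1)"
    by (subst Upow_Suc) (simp add: S_U flip: m_assoc)
  then have eq: "U \<otimes> U \<otimes> (S \<otimes> Upow (k - 1)) = Upow (2 * k) \<otimes> S"
    by (simp add: step2)
  have "S \<otimes> Upow (k - 1) = U\<^sup>\<star> \<otimes> (U\<^sup>\<star> \<otimes> U) \<otimes> U \<otimes> (S \<otimes> Upow (k - 1))"
    by (simp add: star_U_U)
  also have "\<dots> = U\<^sup>\<star> \<otimes> (U\<^sup>\<star> \<otimes> (U \<otimes> U \<otimes> (S \<otimes> Upow (k - 1))))"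
    by (simp add: m_assoc)
  also have "\<dots> = Upow (2 * k - 1 - 1) \<otimes> S"
    using Upow_pred[of "2 * k - 1"] Upow_pred[of "2 * k"] by (simp only: eq) (simp add: m_assoc)
  finally show ?case
    by (simp add: algebra_simps)
qed simp

lemma S_pow_Upow: "S [^] (n::nat) \<otimes> Upow k = Upow (2 ^ n * k) \<otimes> S [^] n"
proof (induction n arbitrary: k)
  case (Suc n)
  have "S [^] Suc n \<otimes> Upow k = S [^] n \<otimes> Upow (2 * k) \<otimes> S"
    by (simp add: m_assoc S_Upow)
  then show ?case
    by (simp add: Suc m_assoc ac_simps)
qed simp

text \<open>On \<open>\<ell>\<^sup>2(\<int>)\<close>, where \<open>U\<close> translates the basis by 1 and \<open>S\<close> sends \<open>e\<^sub>k\<close> to \<open>e\<^sub>2\<^sub>k\<close>, this isometry is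
  induced by the affine map \<open>k \<mapsto> a + 2\<^sup>m k\<close>. All computations with the generators reduce to the
  composition of such maps, and the range projections are indexed by the residue classes
  \<open>a\<close> mod \<open>2\<^sup>m\<close>.\<close>

definition aff :: "int \<Rightarrow> nat \<Rightarrow> 'a" where
  "aff a m = Upow a \<otimes> S [^] m"

lemma aff_closed [simp, intro]: "aff a m \<in> carrier A"
  by (simp add: aff_def)

lemma aff_0_0 [simp]: "aff 0 0 = \<one>"
  by (simp add: aff_def)

lemma aff_U: "aff 1 0 = U" and aff_S: "aff 0 1 = S" and aff_US: "aff 1 1 = U \<otimes> S"
  by (simp_all add: aff_def)

lemma aff_mult: "aff a m \<otimes> aff b n = aff (a + 2 ^ m * b) (m + n)"
proof -
  have "aff a m \<otimes> aff b n = Upow a \<otimes> (S [^] m \<otimes> Upow b) \<otimes> S [^] n"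
    by (simp add: aff_def m_assoc)
  also have "\<dots> = Upow a \<otimes> Upow (2 ^ m * b) \<otimes> (S [^] m \<otimes> S [^] n)"
    by (simp add: S_pow_Upow m_assoc)
  finally show ?thesis
    by (simp add: aff_def nat_pow_mult Upow_add)
qed

lemma star_S_pow_S_pow: "(S [^] (m::nat))\<^sup>\<star> \<otimes> S [^] m = \<one>"
proof (induction m)
  case (Suc m)
  have "(S [^] Suc m)\<^sup>\<star> \<otimes> S [^] Suc m = S\<^sup>\<star> \<otimes> ((S [^] m)\<^sup>\<star> \<otimes> S [^] m) \<otimes> S"
    by (simp add: star_mult m_assoc)
  then show ?case
    by (simp add: Suc star_S_S)
qed simp

lemma aff_isometry: "(aff a m)\<^sup>\<star> \<otimes> aff a m = \<one>"
proof -
  have "(aff a m)\<^sup>\<star> \<otimes> aff a m = (S [^] m)\<^sup>\<star> \<otimes> (Upow (- a) \<otimes> Upow a) \<otimes> S [^] m"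
    by (simp add: aff_def star_mult star_Upow m_assoc)
  then show ?thesis
    by (simp add: star_S_pow_S_pow flip: Upow_add)
qed

text \<open>Compressing \<open>S S\<^sup>\<star> + (US)(US)\<^sup>\<star> = 1\<close> by \<open>S\<close> leaves \<open>1 + y y\<^sup>\<star> = 1\<close> with \<open>y = S\<^sup>\<star>US\<close>, and the
  C*-identity gives \<open>y = 0\<close>.\<close>

lemma star_S_U_S: "S\<^sup>\<star> \<otimes> (U \<otimes> S) = \<zero>"
proof -
  let ?y = "S\<^sup>\<star> \<otimes> (U \<otimes> S)"
  have y: "?y \<in> carrier A"
    by simp
  have ys: "?y\<^sup>\<star> = (U \<otimes> S)\<^sup>\<star> \<otimes> S"
    by (simp add: star_mult)
  have "\<one> = S\<^sup>\<star> \<otimes> (S \<otimes> S\<^sup>\<star> \<oplus> (U \<otimes> S) \<otimes> (U \<otimes> S)\<^sup>\<star>) \<otimes> S"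
    by (simp only: range_sum) (simp add: star_S_S)
  also have "\<dots> = (S\<^sup>\<star> \<otimes> S) \<otimes> (S\<^sup>\<star> \<otimes> S) \<oplus> ?y \<otimes> ?y\<^sup>\<star>"
    unfolding ys by (simp add: r_distr l_distr m_assoc)
  finally have "\<one> \<oplus> ?y \<otimes> ?y\<^sup>\<star> = \<one>"
    by (simp add: star_S_S)
  then have "?y \<otimes> ?y\<^sup>\<star> = \<zero>"
    using y by (metis add.r_cancel_one' m_closed one_closed star_closed a_comm)
  then have "(nrm A (?y\<^sup>\<star>))\<^sup>2 = 0"
    using cstar_identity[of "?y\<^sup>\<star>"] by simp
  then show ?thesis
    using nrm_eq_0[OF y] nrm_star[OF y] by simp
qed

lemma star_S_Upow_S:
  "S\<^sup>\<star> \<otimes> Upow k \<otimes> S = (if even k then Upow (k div 2) else \<zero>)"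
proof -
  have even: "S\<^sup>\<star> \<otimes> Upow (2 * j) = Upow j \<otimes> S\<^sup>\<star>" for j
  proof -
    have "(S \<otimes> Upow (- j))\<^sup>\<star> = (Upow (2 * - j) \<otimes> S)\<^sup>\<star>"
      by (simp only: S_Upow)
    then show ?thesis
      by (simp add: star_mult star_Upow)
  qed
  show ?thesis
  proof (cases "even k")
    case True
    then obtain j where "k = 2 * j" ..
    then show ?thesis
      by (simp add: even m_assoc star_S_S)
  next
    case False
    then obtain j where "k = 2 * j + 1"
      by (elim oddE)
    moreover have "S\<^sup>\<star> \<otimes> (Upow (2 * j) \<otimes> U) \<otimes> S = Upow j \<otimes> (S\<^sup>\<star> \<otimes> (U \<otimes> S))"
      using even[of j] by (simp flip: m_assoc)
    ultimately show ?thesis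
      by (simp add: Upow_add star_S_U_S)
  qed
qed

lemma star_S_pow_Upow_S_pow:
  assumes "\<not> 2 ^ m dvd k"
  shows "(S [^] m)\<^sup>\<star> \<otimes> Upow k \<otimes> S [^] (m::nat) = \<zero>"
  using assms
proof (induction m arbitrary: k)
  case (Suc m)
  have "(S [^] Suc m)\<^sup>\<star> \<otimes> Upow k \<otimes> S [^] Suc m = (S [^] m)\<^sup>\<star> \<otimes> (S\<^sup>\<star> \<otimes> Upow k \<otimes> S) \<otimes> S [^] m"
    using nat_pow_Suc2[of S m] by (simp add: star_mult m_assoc del: nat_pow_Suc)
  also have "\<dots> = \<zero>"
  proof (cases "even k")
    case True
    then have "\<not> 2 ^ m dvd k div 2"
      using Suc.prems by (auto elim!: evenE)
    then show ?thesis
      using True by (simp add: star_S_Upow_S Suc.IH)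
  qed (simp add: star_S_Upow_S)
  finally show ?case .
qed simp

lemma aff_orthogonal:
  assumes "\<not> 2 ^ m dvd b - a"
  shows "(aff a m)\<^sup>\<star> \<otimes> aff b m = \<zero>"
proof -
  have "(aff a m)\<^sup>\<star> \<otimes> aff b m = (S [^] m)\<^sup>\<star> \<otimes> (Upow (- a) \<otimes> Upow b) \<otimes> S [^] m"
    by (simp add: aff_def star_mult star_Upow m_assoc)
  then show ?thesis
    using star_S_pow_Upow_S_pow[OF assms] by (simp flip: Upow_add)
qed

text \<open>Two residue classes modulo powers of 2 are nested or disjoint; in the nested case the finer one is
  reached from the coarser one by another affine map.\<close>

lemma star_aff_aff:
  assumes "m \<le> n"
  shows "(aff a m)\<^sup>\<star> \<otimes> aff b n = (if 2 ^ m dvd b - a then aff ((b - a) div 2 ^ m) (n - m) else \<zero>)"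
proof (cases "2 ^ m dvd b - a")
  case True
  then have "aff b n = aff a m \<otimes> aff ((b - a) div 2 ^ m) (n - m)"
    using assms by (simp add: aff_mult)
  then show ?thesis
    using True by (simp add: aff_isometry flip: m_assoc)
next
  case False
  have "aff b n = aff b m \<otimes> aff 0 (n - m)"
    using assms by (simp add: aff_mult)
  then show ?thesis
    using False by (simp add: aff_orthogonal flip: m_assoc)
qed

lemma nrm_aff_le: "nrm A (aff a m) \<le> 1"
  by (simp add: aff_isometry nrm_isometry_le)

text \<open>The range projection of \<open>aff a m\<close>, which is the indicator function of the residue class of \<open>a\<close>
  modulo \<open>2\<^sup>m\<close>.\<close>

definition cylinder :: "int \<Rightarrow> nat \<Rightarrow> 'a" where
  "cylinder a m = aff a m \<otimes> (aff a m)\<^sup>\<star>"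

lemma cylinder_closed [simp, intro]: "cylinder a m \<in> carrier A"
  by (simp add: cylinder_def)

lemma star_cylinder [simp]: "(cylinder a m)\<^sup>\<star> = cylinder a m"
  by (simp add: cylinder_def star_mult)

lemma cylinder_affine: "cylinder a m \<otimes> aff a m = aff a m"
  by (simp add: cylinder_def m_assoc aff_isometry)

lemma cylinder_idem: "cylinder a m \<otimes> cylinder a m = cylinder a m"
proof -
  have "cylinder a m \<otimes> cylinder a m = (cylinder a m \<otimes> aff a m) \<otimes> (aff a m)\<^sup>\<star>"
    by (simp add: cylinder_def m_assoc)
  then show ?thesis
    by (simp only: cylinder_affine) (simp add: cylinder_def)
qed

lemma cylinder_shift:
  assumes "2 ^ m dvd b - a"
  shows "cylinder a m = cylinder b m"
proof -
  define c where "c = (b - a) div 2 ^ m"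
  have b: "aff b m = aff a m \<otimes> Upow c"
    using assms aff_mult[of a m c 0] by (simp add: c_def aff_def)
  have "cylinder b m = aff a m \<otimes> (Upow c \<otimes> Upow (- c)) \<otimes> (aff a m)\<^sup>\<star>"
    by (simp add: cylinder_def b star_mult star_Upow m_assoc)
  then show ?thesis
    by (simp add: cylinder_def flip: Upow_add)
qed

lemma cylinder_mult:
  assumes "m \<le> n"
  shows "cylinder a m \<otimes> cylinder b n = (if 2 ^ m dvd b - a then cylinder b n else \<zero>)"
    and "cylinder b n \<otimes> cylinder a m = (if 2 ^ m dvd b - a then cylinder b n else \<zero>)"
proof -
  have *: "cylinder a m \<otimes> aff b n = (if 2 ^ m dvd b - a then aff b n else \<zero>)"
    using assms by (simp add: cylinder_def m_assoc star_aff_aff aff_mult)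
  have "cylinder a m \<otimes> cylinder b n = (cylinder a m \<otimes> aff b n) \<otimes> (aff b n)\<^sup>\<star>"
    by (simp add: cylinder_def[of b] m_assoc)
  then show 1: "cylinder a m \<otimes> cylinder b n = (if 2 ^ m dvd b - a then cylinder b n else \<zero>)"
    unfolding * by (simp add: cylinder_def[of b])
  have "cylinder b n \<otimes> cylinder a m = (cylinder a m \<otimes> cylinder b n)\<^sup>\<star>"
    by (simp add: star_mult)
  then show "cylinder b n \<otimes> cylinder a m = (if 2 ^ m dvd b - a then cylinder b n else \<zero>)"
    unfolding 1 by simp
qed

lemma cylinder_commute: "cylinder a m \<otimes> cylinder b n = cylinder b n \<otimes> cylinder a m"
  by (cases m n rule: le_cases) (simp_all add: cylinder_mult)

text \<open>The classes modulo \<open>2\<^sup>m\<close> partition unity, and \<open>K\<close> consecutive periods cover it \<open>K\<close> times. In the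
  induction step, the even and the odd terms at the next level are the images of the present sum
  under \<open>S\<close> and \<open>US\<close>.\<close>

lemma sum_cylinder:
  "(\<Oplus>t\<in>{..<K * 2 ^ m}. cylinder (int t) m) = of_nat K \<odot> \<one>"
proof (induction m)
  case 0
  have "(\<Oplus>t\<in>{..<K}. \<one>) = of_nat K \<odot> \<one>"
    by (induction K) (simp_all add: finsum_lessThan_Suc scale_add_left)
  then show ?case
    using cylinder_shift[of 0 0] by (simp add: cylinder_def[of 0 0])
next
  case (Suc m)
  define Z where "Z = (\<Oplus>t\<in>{..<K * 2 ^ m}. cylinder (int t) m)"
  have conj: "aff c (Suc m) = X \<otimes> aff (int t) m \<Longrightarrow> X \<in> carrier A \<Longrightarrow>
      cylinder c (Suc m) = X \<otimes> cylinder (int t) m \<otimes> X\<^sup>\<star>" for c X t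
    by (simp add: cylinder_def star_mult m_assoc)
  have ev: "cylinder (2 * int t) (Suc m) = S \<otimes> cylinder (int t) m \<otimes> S\<^sup>\<star>" for t
    using aff_mult[of 0 1 "int t" m] by (intro conj) (simp_all add: aff_S[simplified])
  have od: "cylinder (1 + 2 * int t) (Suc m) = (U \<otimes> S) \<otimes> cylinder (int t) m \<otimes> (U \<otimes> S)\<^sup>\<star>" for t
    using aff_mult[of 1 1 "int t" m] by (intro conj) (simp_all add: aff_US[simplified])
  have conj_sum: "(\<Oplus>t\<in>{..<N}. X \<otimes> cylinder (int t) m \<otimes> X\<^sup>\<star>)
      = X \<otimes> (\<Oplus>t\<in>{..<N}. cylinder (int t) m) \<otimes> X\<^sup>\<star>" if "X \<in> carrier A" for X and N :: nat
    using that by (simp add: finsum_ldistr finsum_rdistr Pi_def)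
  have "(\<Oplus>t\<in>{..<K * 2 ^ Suc m}. cylinder (int t) (Suc m))
      = (\<Oplus>t\<in>{..<K * 2 ^ m}. S \<otimes> cylinder (int t) m \<otimes> S\<^sup>\<star>
           \<oplus> (U \<otimes> S) \<otimes> cylinder (int t) m \<otimes> (U \<otimes> S)\<^sup>\<star>)"
    using finsum_double[of "\<lambda>t. cylinder (int t) (Suc m)" "K * 2 ^ m"] by (simp add: ev od mult.left_commute)
  also have "\<dots> = S \<otimes> Z \<otimes> S\<^sup>\<star> \<oplus> (U \<otimes> S) \<otimes> Z \<otimes> (U \<otimes> S)\<^sup>\<star>"
    unfolding Z_def by (subst finsum_addf) (simp_all add: conj_sum Pi_def)
  also have "\<dots> = of_nat K \<odot> (S \<otimes> S\<^sup>\<star> \<oplus> (U \<otimes> S) \<otimes> (U \<otimes> S)\<^sup>\<star>)"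
    by (simp add: Z_def Suc smult_mult_left smult_mult_right scale_add_right)
  finally show ?case
    by (simp add: range_sum)
qed


section \<open>The diagonal and the dense span of monomials\<close>

definition cylinders :: "'a set" where
  "cylinders = {cylinder a m | a m. True}"

lemma cylinders_subset: "cylinders \<subseteq> carrier A"
  by (auto simp: cylinders_def)

lemma cylindersI: "cylinder a m \<in> cylinders"
  unfolding cylinders_def by blast

lemma cylindersE:
  assumes "x \<in> cylinders"
  obtains a m where "x = cylinder a m"
  using assms unfolding cylinders_def by blast

text \<open>The word \<open>\<mu>\<close> is the binary expansion, least significant digit first, of the residue that belongs to
  its isometry; the index 1 is the digit 1 and the index 2 is the digit 0.\<close>

fun word_residue :: "nat list \<Rightarrow> int" where
  "word_residue [] = 0"
| "word_residue (i # \<mu>) = (if i = 1 then 1 else 0) + 2 * word_residue \<mu>"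

lemma word_isometry_aff: "word_isometry A U S \<mu> = aff (word_residue \<mu>) (length \<mu>)"
proof (induction \<mu>)
  case (Cons i \<mu>)
  have "gen_isometry A U S i = aff (if i = 1 then 1 else 0) 1"
    using aff_S aff_US by (simp add: gen_isometry_def)
  then show ?case
    using Cons by (simp add: word_isometry_def aff_mult)
qed (simp add: word_isometry_def)

text \<open>Every residue class modulo \<open>2\<^sup>m\<close> comes from a word of length \<open>m\<close>, so the projections of words are
  exactly the cylinders.\<close>

lemma word_residue_surj: "\<exists>\<mu>. set \<mu> \<subseteq> {1, 2} \<and> length \<mu> = m \<and> 2 ^ m dvd word_residue \<mu> - a"
proof (induction m arbitrary: a)
  case (Suc m)
  define r where "r = (if odd a then 1 else 0 :: int)"
  obtain b where b: "a = r + 2 * b"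
    by (cases "odd a") (auto simp: r_def elim!: oddE evenE)
  obtain \<mu> where \<mu>: "set \<mu> \<subseteq> {1, 2}" "length \<mu> = m" "2 ^ m dvd word_residue \<mu> - b"
    using Suc by blast
  have "word_residue ((if odd a then 1 else 2) # \<mu>) = r + 2 * word_residue \<mu>"
    by (simp add: r_def)
  moreover have "w - a = 2 * (v - b)" if "w = r + 2 * v" for w v
    using that b by simp
  ultimately have "word_residue ((if odd a then 1 else 2) # \<mu>) - a = 2 * (word_residue \<mu> - b)"
    by blast
  then have "2 ^ Suc m dvd word_residue ((if odd a then 1 else 2) # \<mu>) - a"
    using mult_dvd_mono[OF dvd_refl \<mu>(3)] by (simp only: power_Suc)
  then show ?case
    using \<mu>(1,2) by (intro exI[of _ "(if odd a then 1 else 2) # \<mu>"]) auto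
qed auto

lemma diagonal_subalgebra_eq: "diagonal_subalgebra A U S = closed_linear_span A cylinders"
proof -
  have "{word_isometry A U S \<mu> \<otimes> (word_isometry A U S \<mu>)\<^sup>\<star> | \<mu>. set \<mu> \<subseteq> {1, 2}} = cylinders"
  proof (intro equalityI subsetI)
    fix x assume "x \<in> cylinders"
    then obtain a m where x: "x = cylinder a m"
      by (elim cylindersE)
    obtain \<mu> where \<mu>: "set \<mu> \<subseteq> {1, 2}" "length \<mu> = m" "2 ^ m dvd word_residue \<mu> - a"
      using word_residue_surj by blast
    then have "x = word_isometry A U S \<mu> \<otimes> (word_isometry A U S \<mu>)\<^sup>\<star>"
      using cylinder_shift[OF \<mu>(3)] by (simp add: x word_isometry_aff cylinder_def)
    then show "x \<in> {word_isometry A U S \<mu> \<otimes> (word_isometry A U S \<mu>)\<^sup>\<star> | \<mu>. set \<mu> \<subseteq> {1, 2}}"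
      using \<mu>(1) by blast
  next
    fix x assume "x \<in> {word_isometry A U S \<mu> \<otimes> (word_isometry A U S \<mu>)\<^sup>\<star> | \<mu>. set \<mu> \<subseteq> {1, 2}}"
    then obtain \<mu> where "x = word_isometry A U S \<mu> \<otimes> (word_isometry A U S \<mu>)\<^sup>\<star>"
      by (elim CollectE exE conjE)
    then show "x \<in> cylinders"
      unfolding word_isometry_aff cylinder_def[symmetric] by (simp only: cylindersI)
  qed
  then show ?thesis
    unfolding diagonal_subalgebra_def by (rule arg_cong)
qed

lemma abelian_diagonal: "abelian_cstar_subalgebra A (closed_linear_span A cylinders)"
proof -
  have "cstar_subalgebra A (closed_linear_span A cylinders)"
  proof (rule cstar_subalgebra_closed_linear_span[OF cylinders_subset])
    show "x\<^sup>\<star> \<in> lspan cylinders" if "x \<in> cylinders" for x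
      using that lspan_incl[OF that] by (elim cylindersE) simp
    fix x y assume "x \<in> cylinders" "y \<in> cylinders"
    then obtain a m b n where xy: "x = cylinder a m" "y = cylinder b n"
      by (elim cylindersE)
    have "cylinder c k \<in> lspan cylinders" for c k
      by (rule lspan_incl[OF cylindersI])
    then show "x \<otimes> y \<in> lspan cylinders"
      unfolding xy by (cases m n rule: le_cases) (simp_all add: cylinder_mult lspan_zero)
  qed
  moreover have "x \<otimes> y = y \<otimes> x"
    if x: "x \<in> closed_linear_span A cylinders" and y: "y \<in> closed_linear_span A cylinders" for x y
  proof (rule closed_linear_span_commute[OF x cylinders_subset])
    show yc: "y \<in> carrier A"
      using y by (simp add: closed_linear_span_iff[OF cylinders_subset])
    fix e assume e: "e \<in> cylinders"
    have "y \<otimes> e = e \<otimes> y"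
      by (rule closed_linear_span_commute[OF y cylinders_subset])
        (use e in \<open>auto elim!: cylindersE intro: cylinder_commute\<close>)
    then show "e \<otimes> y = y \<otimes> e" ..
  qed
  ultimately show ?thesis
    by (simp add: abelian_cstar_subalgebra_def)
qed

definition monomials :: "'a set" where
  "monomials = {aff a m \<otimes> (aff b n)\<^sup>\<star> | a m b n. True}"

lemma monomials_subset: "monomials \<subseteq> carrier A"
  by (auto simp: monomials_def)

lemma monomialsI: "aff a m \<otimes> (aff b n)\<^sup>\<star> \<in> monomials"
  unfolding monomials_def by blast

text \<open>The inner factor \<open>(aff b n)\<^sup>\<star> (aff c p)\<close> is zero, an affine isometry, or the adjoint of one,
  depending on which of the two levels is finer.\<close>

lemma monomials_mult:
  assumes "x \<in> monomials" "y \<in> monomials"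
  shows "x \<otimes> y \<in> lspan monomials"
proof -
  obtain a m b n c p d q where
    x: "x = aff a m \<otimes> (aff b n)\<^sup>\<star>" and y: "y = aff c p \<otimes> (aff d q)\<^sup>\<star>"
    using assms by (auto simp: monomials_def)
  have xy: "x \<otimes> y = aff a m \<otimes> ((aff b n)\<^sup>\<star> \<otimes> aff c p) \<otimes> (aff d q)\<^sup>\<star>"
    by (simp add: x y m_assoc)
  show ?thesis
  proof (cases "n \<le> p")
    case True
    then show ?thesis
      unfolding xy star_aff_aff[OF True]
      by (simp add: aff_mult lspan_zero lspan_incl monomialsI)
  next
    case False
    then have pn: "p \<le> n"
      by simp
    have "(aff b n)\<^sup>\<star> \<otimes> aff c p = ((aff c p)\<^sup>\<star> \<otimes> aff b n)\<^sup>\<star>"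
      by (simp add: star_mult)
    then have eq: "x \<otimes> y = aff a m \<otimes> (aff d q \<otimes> ((aff c p)\<^sup>\<star> \<otimes> aff b n))\<^sup>\<star>"
      unfolding xy by (simp add: star_mult m_assoc)
    show ?thesis
      unfolding eq star_aff_aff[OF pn]
      by (simp add: aff_mult lspan_zero lspan_incl monomialsI)
  qed
qed

lemma monomials_star: "x \<in> monomials \<Longrightarrow> x\<^sup>\<star> \<in> lspan monomials"
proof -
  assume "x \<in> monomials"
  then obtain a m b n where "x = aff a m \<otimes> (aff b n)\<^sup>\<star>"
    by (auto simp: monomials_def)
  then have "x\<^sup>\<star> = aff b n \<otimes> (aff a m)\<^sup>\<star>"
    by (simp add: star_mult)
  then show ?thesis
    by (simp add: lspan_incl monomialsI)
qed

lemma generators_monomials: "U \<in> monomials" "S \<in> monomials"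
  using monomialsI[of 1 0 0 0] monomialsI[of 0 1 0 0] by (simp_all only: aff_U aff_S aff_0_0 star_one r_one U_closed S_closed)

lemma monomials_dense:
  assumes generated: "cstar_subalgebra A hull {U, S} = carrier A" and x: "x \<in> carrier A" and "\<epsilon> > 0"
  shows "\<exists>y\<in>lspan monomials. nrm A (x \<ominus> y) < \<epsilon>"
proof -
  have "{U, S} \<subseteq> closed_linear_span A monomials"
    using generators_monomials lspan_subset_closed_linear_span[OF monomials_subset]
    by (auto intro: lspan_incl)
  moreover have "cstar_subalgebra A (closed_linear_span A monomials)"
    by (rule cstar_subalgebra_closed_linear_span[OF monomials_subset monomials_mult monomials_star])
  ultimately have "cstar_subalgebra A hull {U, S} \<subseteq> closed_linear_span A monomials"
    by (rule hull_minimal)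
  then have "x \<in> closed_linear_span A monomials"
    using generated x by (simp add: subset_iff)
  then show ?thesis
    using \<open>\<epsilon> > 0\<close> by (simp add: closed_linear_span_iff[OF monomials_subset])
qed

section \<open>Spreading isometries\<close>

text \<open>The partial isometry \<open>probe n l t\<close> maps the class \<open>t\<close> mod \<open>2\<^sup>l\<close> onto the far smaller class
  \<open>t + 2\<^sup>n\<^sup>+\<^sup>l\<close> mod \<open>2\<^sup>2\<^sup>n\<^sup>+\<^sup>l\<close>. If \<open>t < 2\<^sup>n\<^sup>+\<^sup>l\<close>, the binary digits of the members of the
  target, least significant first, are the \<open>n + l\<close> digits of \<open>t\<close>, a single 1, \<open>n - 1\<close> zeros, and then
  anything. This makes the targets with \<open>l < n\<close> pairwise disjoint and keeps them away from the fixed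
  point of any given dilation once \<open>n\<close> is large.\<close>

definition probe :: "nat \<Rightarrow> nat \<Rightarrow> nat \<Rightarrow> 'a" where
  "probe n l t = aff (int t + 2 ^ (n + l)) (n + l + n) \<otimes> (aff (int t) l)\<^sup>\<star>"

text \<open>For each of the \<open>n\<close> levels \<open>l\<close>, the sources with \<open>t < 2\<^sup>n\<^sup>+\<^sup>l\<close> cover the unit \<open>2\<^sup>n\<close> times, whence the
  normalization. The sum over \<open>l\<close> and \<open>t\<close> averages over a long stretch of dilations and
  translations, like a Folner set of the affine group.\<close>

definition spread :: "nat \<Rightarrow> 'a" where
  "spread n = of_real (1 / sqrt (real (n * 2 ^ n))) \<odot> (\<Oplus>l\<in>{..<n}. \<Oplus>t\<in>{..<2 ^ (n + l)}. probe n l t)"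

lemma probe_closed [simp, intro]: "probe n l t \<in> carrier A"
  by (simp add: probe_def)

lemma nrm_probe_le: "nrm A (probe n l t) \<le> 1"
  using nrm_mult_le_left[of "aff (int t + 2 ^ (n + l)) (n + l + n)" "(aff (int t) l)\<^sup>\<star>"]
    nrm_aff_le[of "int t" l] by (simp add: probe_def nrm_star nrm_aff_le[of "int t + 2 ^ (n + l)"])

lemma star_probe_probe: "(probe n l t)\<^sup>\<star> \<otimes> probe n l t = cylinder (int t) l"
proof -
  let ?w = "aff (int t + 2 ^ (n + l)) (n + l + n)"
  have "(probe n l t)\<^sup>\<star> \<otimes> probe n l t = aff (int t) l \<otimes> (?w\<^sup>\<star> \<otimes> ?w) \<otimes> (aff (int t) l)\<^sup>\<star>"
    by (simp add: probe_def star_mult m_assoc)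
  then show ?thesis
    by (simp add: aff_isometry cylinder_def)
qed

definition probe_range :: "nat \<Rightarrow> nat \<Rightarrow> nat \<Rightarrow> 'a" where
  "probe_range n l t = cylinder (int t + 2 ^ (n + l)) (n + l + n)"

lemma probe_range_probe: "probe_range n l t \<otimes> probe n l t = probe n l t"
  by (simp add: probe_range_def probe_def cylinder_affine flip: m_assoc)

lemma not_dvd_between: "0 < k \<Longrightarrow> k < d \<Longrightarrow> \<not> d dvd (k :: int)"
  by (auto dest: zdvd_imp_le)

text \<open>The difference of the two representatives is positive, as \<open>2\<^sup>n\<^sup>+\<^sup>l\<^sup>'\<close> exceeds everything below
  \<open>2\<^sup>n\<^sup>+\<^sup>l\<^sup>+\<^sup>1\<close>, and it is below the coarser modulus \<open>2\<^sup>2\<^sup>n\<^sup>+\<^sup>l\<close>, as \<open>l' < n\<close>.\<close>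

lemma probe_range_orthogonal_less:
  assumes "l < l'" "l' < n" "t < 2 ^ (n + l)" "t' < 2 ^ (n + l')"
  shows "probe_range n l t \<otimes> probe_range n l' t' = \<zero>"
    and "probe_range n l' t' \<otimes> probe_range n l t = \<zero>"
proof -
  define k where "k = (int t' + 2 ^ (n + l')) - (int t + 2 ^ (n + l))"
  have t: "int t < 2 ^ (n + l)" "int t' < 2 ^ (n + l')"
    using assms(3,4) by (metis of_nat_less_iff of_nat_numeral of_nat_power)+
  have "(2::int) ^ Suc (n + l) \<le> 2 ^ (n + l')"
    using assms(1) by (intro power_increasing) auto
  then have "0 < k"
    using t unfolding k_def power_Suc by linarith
  moreover have "(2::int) ^ Suc (n + l') \<le> 2 ^ (n + l + n)"
    using assms(2) by (intro power_increasing) auto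
  then have "k < 2 ^ (n + l + n)"
    using t unfolding k_def power_Suc by linarith
  ultimately have "\<not> 2 ^ (n + l + n) dvd k"
    by (rule not_dvd_between)
  then show "probe_range n l t \<otimes> probe_range n l' t' = \<zero>"
    and "probe_range n l' t' \<otimes> probe_range n l t = \<zero>"
    using assms(1) unfolding probe_range_def k_def by (simp_all add: cylinder_mult)
qed

lemma probe_range_orthogonal_same:
  assumes "t < 2 ^ (n + l)" "t' < 2 ^ (n + l)" "t \<noteq> t'"
  shows "probe_range n l t \<otimes> probe_range n l t' = \<zero>"
proof -
  have t: "int t < 2 ^ (n + l)" "int t' < 2 ^ (n + l)"
    using assms(1,2) by (metis of_nat_less_iff of_nat_numeral of_nat_power)+
  have le: "(2::int) ^ (n + l) \<le> 2 ^ (n + l + n)"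
    by (intro power_increasing) auto
  have "\<not> 2 ^ (n + l + n) dvd int t' - int t"
  proof (cases "t < t'")
    case True
    then show ?thesis
      using t le by (intro not_dvd_between) linarith+
  next
    case False
    then have "\<not> 2 ^ (n + l + n) dvd int t - int t'"
      using t le assms(3) by (intro not_dvd_between) linarith+
    then show ?thesis
      using dvd_minus_iff[of "2 ^ (n + l + n)" "int t - int t'"] by simp
  qed
  then show ?thesis
    by (simp add: probe_range_def cylinder_mult)
qed

lemma probe_range_orthogonal:
  assumes "l < n" "l' < n" "t < 2 ^ (n + l)" "t' < 2 ^ (n + l')" "(l, t) \<noteq> (l', t')"
  shows "probe_range n l t \<otimes> probe_range n l' t' = \<zero>"
proof (cases l l' rule: linorder_cases)
  case equal
  then show ?thesis
    using assms probe_range_orthogonal_same by auto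
qed (use assms probe_range_orthogonal_less in auto)

text \<open>An element that commutes with the diagonal is diagonal with respect to any orthogonal family of
  cylinders, in particular the ranges of the probes.\<close>

lemma probe_cross_zero:
  assumes a: "a \<in> carrier A" and comm: "\<And>b m. a \<otimes> cylinder b m = cylinder b m \<otimes> a"
    and orth: "probe_range n l t \<otimes> probe_range n l' t' = \<zero>"
  shows "(probe n l t)\<^sup>\<star> \<otimes> a \<otimes> probe n l' t' = \<zero>"
proof -
  let ?q = "probe_range n l t" and ?q' = "probe_range n l' t'"
  have q: "?q \<in> carrier A" "?q' \<in> carrier A" "?q\<^sup>\<star> = ?q"
    by (simp_all add: probe_range_def)
  have "(probe n l t)\<^sup>\<star> \<otimes> a \<otimes> probe n l' t' = (?q \<otimes> probe n l t)\<^sup>\<star> \<otimes> a \<otimes> (?q' \<otimes> probe n l' t')"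
    by (simp only: probe_range_probe)
  also have "\<dots> = (probe n l t)\<^sup>\<star> \<otimes> (?q \<otimes> a) \<otimes> (?q' \<otimes> probe n l' t')"
    using q a by (simp add: star_mult m_assoc)
  also have "?q \<otimes> a = a \<otimes> ?q"
    by (simp add: probe_range_def comm)
  also have "(probe n l t)\<^sup>\<star> \<otimes> (a \<otimes> ?q) \<otimes> (?q' \<otimes> probe n l' t')
      = (probe n l t)\<^sup>\<star> \<otimes> a \<otimes> (?q \<otimes> ?q') \<otimes> probe n l' t'"
    using q a by (simp add: m_assoc)
  finally show ?thesis
    using a by (simp add: orth)
qed

lemma spread_closed [simp, intro]: "spread n \<in> carrier A"
  by (simp add: spread_def Pi_def)

lemma spread_sandwich:
  assumes a: "a \<in> carrier A"
    and zero: "\<And>l t l' t'. l < n \<Longrightarrow> l' < n \<Longrightarrow> t < 2 ^ (n + l) \<Longrightarrow> t' < 2 ^ (n + l') \<Longrightarrow>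
      (l, t) \<noteq> (l', t') \<Longrightarrow> (probe n l t)\<^sup>\<star> \<otimes> a \<otimes> probe n l' t' = \<zero>"
  shows "(spread n)\<^sup>\<star> \<otimes> a \<otimes> spread n = of_real (1 / real (n * 2 ^ n)) \<odot>
     (\<Oplus>l\<in>{..<n}. \<Oplus>t\<in>{..<2 ^ (n + l)}. (probe n l t)\<^sup>\<star> \<otimes> a \<otimes> probe n l t)"
proof -
  let ?r = "of_real (1 / sqrt (real (n * 2 ^ n))) :: complex"
  let ?G = "\<Oplus>l\<in>{..<n}. \<Oplus>t\<in>{..<2 ^ (n + l)}. probe n l t"
  have G: "?G \<in> carrier A"
    by (simp add: Pi_def)
  have "?G\<^sup>\<star> \<otimes> a \<otimes> ?G = (\<Oplus>l\<in>{..<n}. \<Oplus>t\<in>{..<2 ^ (n + l)}. (probe n l t)\<^sup>\<star> \<otimes> a \<otimes> probe n l t)"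
    using a zero by (intro sandwich_finsum_finsum) auto
  moreover have "(spread n)\<^sup>\<star> \<otimes> a \<otimes> spread n = (?r * ?r) \<odot> (?G\<^sup>\<star> \<otimes> a \<otimes> ?G)"
    unfolding spread_def using G a
    by (simp add: star_smult smult_mult_left smult_mult_right scale_scale)
  moreover have "?r * ?r = of_real (1 / real (n * 2 ^ n))"
    by (simp flip: of_real_mult)
  ultimately show ?thesis
    by simp
qed

lemma sum_cylinder_pow: "(\<Oplus>t\<in>{..<2 ^ (n + l)}. cylinder (int t) l) = of_real (2 ^ n) \<odot> \<one>"
  using sum_cylinder[where K = "2 ^ n" and m = l] by (simp add: power_add)

lemma finsum_one: "(\<Oplus>l\<in>{..<(n::nat)}. c \<odot> \<one>) = (of_nat n * c) \<odot> \<one>"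
  by (induction n) (simp_all add: finsum_lessThan_Suc scale_add_left distrib_right)

lemma spread_isometry:
  assumes "0 < n"
  shows "(spread n)\<^sup>\<star> \<otimes> spread n = \<one>"
proof -
  have "(spread n)\<^sup>\<star> \<otimes> \<one> \<otimes> spread n = of_real (1 / real (n * 2 ^ n)) \<odot>
     (\<Oplus>l\<in>{..<n}. \<Oplus>t\<in>{..<2 ^ (n + l)}. (probe n l t)\<^sup>\<star> \<otimes> \<one> \<otimes> probe n l t)"
    by (intro spread_sandwich probe_cross_zero probe_range_orthogonal) auto
  also have "\<dots> = (of_real (1 / real (n * 2 ^ n)) * (of_nat n * of_real (2 ^ n))) \<odot> \<one>"
    by (simp add: star_probe_probe sum_cylinder_pow finsum_one scale_scale)
  also have "of_real (1 / real (n * 2 ^ n)) * (of_nat n * of_real (2 ^ n)) = (1 :: complex)"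
    using assms by simp
  finally show ?thesis
    by simp
qed

text \<open>Compression by the spreading isometry sees of an element of the commutant of the diagonal only its
  diagonal corners at the probes. Replacing \<open>a\<close> by a pinching of \<open>a'\<close>, which has the same corners and
  no other ones, gives the bound.\<close>

lemma nrm_spread_sandwich_le:
  assumes n: "0 < n" and a: "a \<in> carrier A" and comm: "\<And>b m. a \<otimes> cylinder b m = cylinder b m \<otimes> a"
    and a': "a' \<in> carrier A"
    and diag: "\<And>l t. l < n \<Longrightarrow> t < 2 ^ (n + l) \<Longrightarrow>
      (probe n l t)\<^sup>\<star> \<otimes> a \<otimes> probe n l t = (probe n l t)\<^sup>\<star> \<otimes> a' \<otimes> probe n l t"
  shows "nrm A ((spread n)\<^sup>\<star> \<otimes> a \<otimes> spread n) \<le> nrm A a'"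
proof -
  define J where "J = (SIGMA l:{..<n}. {..<(2::nat) ^ (n + l)})"
  define q where "q = (\<lambda>(l, t). probe_range n l t)"
  have "\<exists>c\<in>carrier A. nrm A c \<le> nrm A a' \<and> (\<forall>i\<in>J. q i \<otimes> c = q i \<otimes> a' \<otimes> q i) \<and>
      (\<forall>j\<in>J. q j \<otimes> c \<otimes> q j = q j \<otimes> a' \<otimes> q j)"
  proof (rule pinching_exists)
    show "q i \<otimes> q j = \<zero>" if "i \<in> J" "j \<in> J" "i \<noteq> j" for i j
      using that unfolding J_def q_def by (auto intro!: probe_range_orthogonal simp del: Pair_inject)
  qed (use a' in \<open>auto simp: J_def q_def probe_range_def cylinder_idem\<close>)
  then obtain c where c: "c \<in> carrier A" "nrm A c \<le> nrm A a'"
    and qc: "\<And>l t. l < n \<Longrightarrow> t < 2 ^ (n + l) \<Longrightarrow>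
      probe_range n l t \<otimes> c = probe_range n l t \<otimes> a' \<otimes> probe_range n l t"
    by (auto simp: J_def q_def)
  have gc: "(probe n l t)\<^sup>\<star> \<otimes> c \<otimes> x
      = (probe n l t)\<^sup>\<star> \<otimes> a' \<otimes> (probe_range n l t \<otimes> x)"
    if "l < n" "t < 2 ^ (n + l)" "x \<in> carrier A" for l t x
  proof -
    let ?q = "probe_range n l t" and ?g = "probe n l t"
    have q: "?q \<in> carrier A" "?q\<^sup>\<star> = ?q"
      by (simp_all add: probe_range_def)
    have gq: "?g\<^sup>\<star> \<otimes> ?q = ?g\<^sup>\<star>"
      using q probe_range_probe[of n l t] star_mult[of ?q ?g] by simp
    have "?g\<^sup>\<star> \<otimes> c \<otimes> x = ?g\<^sup>\<star> \<otimes> (?q \<otimes> c) \<otimes> x"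
      using q c that gq by (simp flip: m_assoc)
    also have "\<dots> = (?g\<^sup>\<star> \<otimes> ?q) \<otimes> a' \<otimes> (?q \<otimes> x)"
      using q a' that by (simp add: qc m_assoc)
    finally show ?thesis
      by (simp add: gq)
  qed
  have "(spread n)\<^sup>\<star> \<otimes> a \<otimes> spread n = of_real (1 / real (n * 2 ^ n)) \<odot>
     (\<Oplus>l\<in>{..<n}. \<Oplus>t\<in>{..<2 ^ (n + l)}. (probe n l t)\<^sup>\<star> \<otimes> a \<otimes> probe n l t)"
    using a comm by (intro spread_sandwich probe_cross_zero probe_range_orthogonal) auto
  also have "(\<Oplus>l\<in>{..<n}. \<Oplus>t\<in>{..<2 ^ (n + l)}. (probe n l t)\<^sup>\<star> \<otimes> a \<otimes> probe n l t)
      = (\<Oplus>l\<in>{..<n}. \<Oplus>t\<in>{..<2 ^ (n + l)}. (probe n l t)\<^sup>\<star> \<otimes> c \<otimes> probe n l t)"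
    using c a' by (intro finsum_cong' refl) (auto simp: Pi_def gc diag probe_range_probe)
  also have "of_real (1 / real (n * 2 ^ n)) \<odot> \<dots> = (spread n)\<^sup>\<star> \<otimes> c \<otimes> spread n"
  proof (rule spread_sandwich[symmetric, OF c(1)])
    fix l t l' t' :: nat
    assume *: "l < n" "l' < n" "t < 2 ^ (n + l)" "t' < 2 ^ (n + l')" "(l, t) \<noteq> (l', t')"
    have "probe_range n l t \<otimes> probe n l' t'
        = (probe_range n l t \<otimes> probe_range n l' t') \<otimes> probe n l' t'"
      using probe_range_probe[of n l' t'] by (simp add: m_assoc probe_range_def)
    then have "probe_range n l t \<otimes> probe n l' t' = \<zero>"
      by (simp add: probe_range_orthogonal[OF *])
    then show "(probe n l t)\<^sup>\<star> \<otimes> c \<otimes> probe n l' t' = \<zero>"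
      using a' by (simp add: gc *)
  qed
  finally have "nrm A ((spread n)\<^sup>\<star> \<otimes> a \<otimes> spread n) = nrm A ((spread n)\<^sup>\<star> \<otimes> c \<otimes> spread n)"
    by simp
  also have "\<dots> \<le> nrm A c"
    using nrm_mult_le_right[of "(spread n)\<^sup>\<star> \<otimes> c" "spread n"] nrm_mult_le_left[of "(spread n)\<^sup>\<star>" c]
      nrm_isometry_le[OF spread_closed spread_isometry[OF n]] c by (simp add: nrm_star)
  finally show ?thesis
    using c(2) by simp
qed

end

context cstar_algebra
begin

section \<open>Asymptotic centrality\<close>

lemma nrm_commutator_finsum_le:
  assumes b: "b \<in> carrier A" and h: "\<And>i. h i \<in> carrier A"
    and le: "\<And>i. i < N \<Longrightarrow> nrm A (b \<otimes> h i \<ominus> h i \<otimes> b) \<le> K"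
  shows "nrm A (b \<otimes> finsum A h {..<N} \<ominus> finsum A h {..<N} \<otimes> b) \<le> real N * K"
  using le
proof (induction N)
  case 0
  then show ?case using b by (simp add: a_minus_def r_neg)
next
  case (Suc N)
  let ?s = "finsum A h {..<N}"
  have s: "?s \<in> carrier A"
    using h by (simp add: Pi_def)
  have "nrm A ((b \<otimes> h N \<ominus> h N \<otimes> b) \<oplus> (b \<otimes> ?s \<ominus> ?s \<otimes> b))
      \<le> nrm A (b \<otimes> h N \<ominus> h N \<otimes> b) + nrm A (b \<otimes> ?s \<ominus> ?s \<otimes> b)"
    using b h s by (intro nrm_triangle) auto
  also have "\<dots> \<le> K + real N * K"
    using Suc by (intro add_mono) auto
  finally show ?case
    using commutator_add[OF b h s] by (simp add: finsum_lessThan_Suc h distrib_right)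
qed

lemma nrm_commutator_scale:
  assumes "b \<in> carrier A" "x \<in> carrier A"
  shows "nrm A (b \<otimes> (c \<odot> x) \<ominus> (c \<odot> x) \<otimes> b) = cmod c * nrm A (b \<otimes> x \<ominus> x \<otimes> b)"
  using assms by (simp add: smult_mult_left smult_mult_right nrm_smult flip: scale_diff_right)

definition asymptotically_central :: "(nat \<Rightarrow> 'a) \<Rightarrow> 'a \<Rightarrow> bool" where
  "asymptotically_central V b \<longleftrightarrow> (\<lambda>n. nrm A (b \<otimes> V n \<ominus> V n \<otimes> b)) \<longlonglongrightarrow> 0"

lemma asymptotically_central_bound:
  assumes V: "\<And>n. V n \<in> carrier A" and b: "b \<in> carrier A"
    and "\<And>n. nrm A (b \<otimes> V n \<ominus> V n \<otimes> b) \<le> f n" and "f \<longlonglongrightarrow> 0"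
  shows "asymptotically_central V b"
  unfolding asymptotically_central_def
  by (rule tendsto_sandwich[OF _ _ tendsto_const assms(4)]) (use assms nrm_nonneg in auto)

lemma asymptotically_central_zero:
  "(\<And>n. V n \<in> carrier A) \<Longrightarrow> asymptotically_central V \<zero>"
  by (simp add: asymptotically_central_def a_minus_def)

lemma asymptotically_central_one:
  "(\<And>n. V n \<in> carrier A) \<Longrightarrow> asymptotically_central V \<one>"
  by (simp add: asymptotically_central_def a_minus_def r_neg)

lemma asymptotically_central_add:
  assumes V: "\<And>n. V n \<in> carrier A" and c: "b \<in> carrier A" "c \<in> carrier A"
    and "asymptotically_central V b" "asymptotically_central V c"
  shows "asymptotically_central V (b \<oplus> c)"
proof (rule asymptotically_central_bound[OF V])
  fix n
  have "(b \<oplus> c) \<otimes> V n \<ominus> V n \<otimes> (b \<oplus> c) = (b \<otimes> V n \<ominus> V n \<otimes> b) \<oplus> (c \<otimes> V n \<ominus> V n \<otimes> c)"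
    using V[of n] c by algebra
  then show "nrm A ((b \<oplus> c) \<otimes> V n \<ominus> V n \<otimes> (b \<oplus> c))
      \<le> nrm A (b \<otimes> V n \<ominus> V n \<otimes> b) + nrm A (c \<otimes> V n \<ominus> V n \<otimes> c)"
    using V[of n] c by (simp add: nrm_triangle)
  show "(\<lambda>n. nrm A (b \<otimes> V n \<ominus> V n \<otimes> b) + nrm A (c \<otimes> V n \<ominus> V n \<otimes> c)) \<longlonglongrightarrow> 0"
    using tendsto_add assms(4,5) unfolding asymptotically_central_def by fastforce
qed (use c in simp)

lemma asymptotically_central_scale:
  assumes V: "\<And>n. V n \<in> carrier A" and b: "b \<in> carrier A" and "asymptotically_central V b"
  shows "asymptotically_central V (c \<odot> b)"
proof (rule asymptotically_central_bound[OF V])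
  fix n
  show "nrm A ((c \<odot> b) \<otimes> V n \<ominus> V n \<otimes> (c \<odot> b)) \<le> cmod c * nrm A (b \<otimes> V n \<ominus> V n \<otimes> b)"
    using V[of n] b by (simp add: smult_mult_left smult_mult_right nrm_smult flip: scale_diff_right)
  show "(\<lambda>n. cmod c * nrm A (b \<otimes> V n \<ominus> V n \<otimes> b)) \<longlonglongrightarrow> 0"
    using assms(3) tendsto_mult_left_zero[of _ _ "cmod c"] tendsto_mult_right_zero
    unfolding asymptotically_central_def by fastforce
qed (use b in simp)

lemma asymptotically_central_mult:
  assumes V: "\<And>n. V n \<in> carrier A" and c: "b \<in> carrier A" "c \<in> carrier A"
    and "asymptotically_central V b" "asymptotically_central V c"
  shows "asymptotically_central V (b \<otimes> c)"
proof (rule asymptotically_central_bound[OF V])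
  fix n
  have "(b \<otimes> c) \<otimes> V n \<ominus> V n \<otimes> (b \<otimes> c)
      = b \<otimes> (c \<otimes> V n \<ominus> V n \<otimes> c) \<oplus> (b \<otimes> V n \<ominus> V n \<otimes> b) \<otimes> c"
    using V[of n] c by algebra
  also have "nrm A \<dots> \<le> nrm A (b \<otimes> (c \<otimes> V n \<ominus> V n \<otimes> c)) + nrm A ((b \<otimes> V n \<ominus> V n \<otimes> b) \<otimes> c)"
    using V[of n] c by (simp add: nrm_triangle)
  also have "\<dots> \<le> nrm A b * nrm A (c \<otimes> V n \<ominus> V n \<otimes> c) + nrm A (b \<otimes> V n \<ominus> V n \<otimes> b) * nrm A c"
    using V[of n] c by (intro add_mono nrm_mult) auto
  finally show "nrm A ((b \<otimes> c) \<otimes> V n \<ominus> V n \<otimes> (b \<otimes> c))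
      \<le> nrm A b * nrm A (c \<otimes> V n \<ominus> V n \<otimes> c) + nrm A (b \<otimes> V n \<ominus> V n \<otimes> b) * nrm A c" .
  have "(\<lambda>n. nrm A b * nrm A (c \<otimes> V n \<ominus> V n \<otimes> c) + nrm A (b \<otimes> V n \<ominus> V n \<otimes> b) * nrm A c)
      \<longlonglongrightarrow> nrm A b * 0 + 0 * nrm A c"
    using assms(4,5) unfolding asymptotically_central_def by (intro tendsto_intros)
  then show "(\<lambda>n. nrm A b * nrm A (c \<otimes> V n \<ominus> V n \<otimes> c) + nrm A (b \<otimes> V n \<ominus> V n \<otimes> b) * nrm A c)
      \<longlonglongrightarrow> 0"
    by simp
qed (use c in simp)

lemma asymptotically_central_lspan:
  assumes "b \<in> lspan X" and X: "X \<subseteq> carrier A" and V: "\<And>n. V n \<in> carrier A"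
    and "\<And>x. x \<in> X \<Longrightarrow> asymptotically_central V x"
  shows "asymptotically_central V b"
  using assms(1)
  by (induction rule: lspan.induct)
    (use assms(4) lspan_closed[OF _ X] V in \<open>auto intro: asymptotically_central_zero
       asymptotically_central_add asymptotically_central_scale\<close>)

end

context two_adic
begin

text \<open>The part of \<open>spread n\<close> at level \<open>l\<close>, before normalization. Moving \<open>U\<close> past a term of a block raises
  \<open>t\<close> by one, and moving \<open>S\<close> past a block raises \<open>l\<close> by one; so in both cases the commutator with
  \<open>spread n\<close> telescopes.\<close>

definition block :: "nat \<Rightarrow> nat \<Rightarrow> 'a" where
  "block n l = (\<Oplus>t\<in>{..<2 ^ (n + l)}. probe n l t)"

lemma block_closed [simp, intro]: "block n l \<in> carrier A"
  by (simp add: block_def Pi_def)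

lemma spread_block:
  "spread n = of_real (1 / sqrt (real (n * 2 ^ n))) \<odot> (\<Oplus>l\<in>{..<n}. block n l)"
  by (simp add: spread_def block_def)

lemma U_aff: "U \<otimes> aff a m = aff (a + 1) m"
  using aff_mult[of 1 0 a m] by (simp add: aff_U add.commute)

lemma S_aff: "S \<otimes> aff a m = aff (2 * a) (Suc m)"
  using aff_mult[of 0 1 a m] aff_S by simp

lemma U_S_aff: "U \<otimes> (S \<otimes> aff a m) = aff (2 * a + 1) (Suc m)"
  by (simp add: S_aff U_aff)

lemma star_aff_star_U: "(aff a m)\<^sup>\<star> \<otimes> U\<^sup>\<star> = (aff (a + 1) m)\<^sup>\<star>"
  using star_mult[of U "aff a m"] by (simp add: U_aff)

lemma star_aff_star_S: "(aff a m)\<^sup>\<star> \<otimes> S\<^sup>\<star> = (aff (2 * a) (Suc m))\<^sup>\<star>"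
  using star_mult[of S "aff a m"] by (simp add: S_aff)

lemma star_aff_U: "(aff (a + 1) m)\<^sup>\<star> \<otimes> U = (aff a m)\<^sup>\<star>"
  unfolding star_aff_star_U[symmetric] by (simp add: m_assoc star_U_U)

lemma star_aff_even_S: "(aff (2 * a) (Suc m))\<^sup>\<star> \<otimes> S = (aff a m)\<^sup>\<star>"
  unfolding star_aff_star_S[symmetric] by (simp add: m_assoc star_S_S)

lemma star_S_aff_even: "S\<^sup>\<star> \<otimes> aff (2 * a) (Suc m) = aff a m"
  unfolding S_aff[symmetric] by (simp add: star_S_S flip: m_assoc)

lemma star_S_aff_odd: "S\<^sup>\<star> \<otimes> aff (2 * a + 1) (Suc m) = \<zero>"
proof -
  have "S\<^sup>\<star> \<otimes> aff (2 * a + 1) (Suc m) = (S\<^sup>\<star> \<otimes> (U \<otimes> S)) \<otimes> aff a m"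
    unfolding U_S_aff[symmetric] by (simp add: m_assoc)
  then show ?thesis
    by (simp add: star_S_U_S)
qed

lemma star_aff_odd_S: "(aff (2 * a + 1) (Suc m))\<^sup>\<star> \<otimes> S = \<zero>"
proof -
  have "(aff (2 * a + 1) (Suc m))\<^sup>\<star> \<otimes> S = (S\<^sup>\<star> \<otimes> aff (2 * a + 1) (Suc m))\<^sup>\<star>"
    by (simp add: star_mult)
  then show ?thesis
    by (simp add: star_S_aff_odd)
qed

lemma U_probe: "U \<otimes> probe n l t = probe n l (Suc t) \<otimes> U"
proof -
  have "U \<otimes> probe n l t = aff (int t + 1 + 2 ^ (n + l)) (n + l + n) \<otimes> (aff (int t) l)\<^sup>\<star>"
    using U_aff[of "int t + 2 ^ (n + l)" "n + l + n"] by (simp add: probe_def add_ac flip: m_assoc)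
  also have "\<dots> = aff (int t + 1 + 2 ^ (n + l)) (n + l + n) \<otimes> ((aff (int t + 1) l)\<^sup>\<star> \<otimes> U)"
    by (simp only: star_aff_U)
  finally show ?thesis
    by (simp add: probe_def m_assoc add_ac)
qed

lemma star_U_probe: "U\<^sup>\<star> \<otimes> probe n l (Suc t) = probe n l t \<otimes> U\<^sup>\<star>"
proof -
  have "U\<^sup>\<star> \<otimes> probe n l (Suc t) = U\<^sup>\<star> \<otimes> (probe n l (Suc t) \<otimes> U) \<otimes> U\<^sup>\<star>"
    by (simp add: m_assoc U_star_U)
  also have "\<dots> = (U\<^sup>\<star> \<otimes> U) \<otimes> probe n l t \<otimes> U\<^sup>\<star>"
    unfolding U_probe[symmetric] by (simp add: m_assoc)
  finally show ?thesis
    by (simp add: star_U_U)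
qed

lemma probe_Suc_even:
  "probe n (Suc l) (2 * t) = aff (2 * (int t + 2 ^ (n + l))) (Suc (n + l + n)) \<otimes> (aff (2 * int t) (Suc l))\<^sup>\<star>"
  by (simp add: probe_def distrib_left)

lemma probe_Suc_odd:
  "probe n (Suc l) (Suc (2 * t)) =
     aff (2 * (int t + 2 ^ (n + l)) + 1) (Suc (n + l + n)) \<otimes> (aff (2 * int t + 1) (Suc l))\<^sup>\<star>"
  by (simp add: probe_def distrib_left add_ac)

text \<open>\<open>S\<close> intertwines the term \<open>t\<close> at level \<open>l\<close> with the term \<open>2 t\<close> at level \<open>l + 1\<close>, and it kills the odd
  terms at level \<open>l + 1\<close> by \<open>S\<^sup>\<star>US = 0\<close>.\<close>

lemma S_block: "S \<otimes> block n l = block n (Suc l) \<otimes> S"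
proof -
  have even: "probe n (Suc l) (2 * t) \<otimes> S = S \<otimes> probe n l t" for t
    by (simp add: probe_Suc_even m_assoc star_aff_even_S)
      (simp add: probe_def S_aff flip: m_assoc)
  have odd: "probe n (Suc l) (Suc (2 * t)) \<otimes> S = \<zero>" for t
    by (simp add: probe_Suc_odd m_assoc star_aff_odd_S)
  have "block n (Suc l) \<otimes> S = (\<Oplus>t\<in>{..<2 * 2 ^ (n + l)}. probe n (Suc l) t \<otimes> S)"
    by (simp add: block_def finsum_ldistr Pi_def)
  also have "\<dots> = (\<Oplus>t\<in>{..<2 ^ (n + l)}. S \<otimes> probe n l t)"
    by (subst finsum_double) (simp_all add: even odd)
  also have "\<dots> = S \<otimes> block n l"
    by (simp add: block_def finsum_rdistr Pi_def)
  finally show ?thesis ..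
qed

lemma star_S_block: "S\<^sup>\<star> \<otimes> block n (Suc l) = block n l \<otimes> S\<^sup>\<star>"
proof -
  have even: "S\<^sup>\<star> \<otimes> probe n (Suc l) (2 * t) = probe n l t \<otimes> S\<^sup>\<star>" for t
  proof -
    have "S\<^sup>\<star> \<otimes> probe n (Suc l) (2 * t)
        = aff (int t + 2 ^ (n + l)) (n + l + n) \<otimes> (aff (2 * int t) (Suc l))\<^sup>\<star>"
      unfolding probe_Suc_even star_S_aff_even[symmetric, of "int t + 2 ^ (n + l)"]
      by (simp add: m_assoc)
    then show ?thesis
      by (simp add: probe_def m_assoc star_aff_star_S)
  qed
  have odd: "S\<^sup>\<star> \<otimes> probe n (Suc l) (Suc (2 * t)) = \<zero>" for t
    unfolding probe_Suc_odd
    using star_S_aff_odd[of "int t + 2 ^ (n + l)" "n + l + n"] by (simp flip: m_assoc)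
  have "S\<^sup>\<star> \<otimes> block n (Suc l) = (\<Oplus>t\<in>{..<2 * 2 ^ (n + l)}. S\<^sup>\<star> \<otimes> probe n (Suc l) t)"
    by (simp add: block_def finsum_rdistr Pi_def)
  also have "\<dots> = (\<Oplus>t\<in>{..<2 ^ (n + l)}. probe n l t \<otimes> S\<^sup>\<star>)"
    by (subst finsum_double) (simp_all add: even odd)
  also have "\<dots> = block n l \<otimes> S\<^sup>\<star>"
    by (simp add: block_def finsum_ldistr Pi_def)
  finally show ?thesis .
qed

text \<open>By orthogonality of the ranges inside a block \<open>B\<close>, the product \<open>B\<^sup>\<star>B\<close> is the sum of the sources,
  which is \<open>2\<^sup>n\<close> times the unit.\<close>

lemma nrm_block_le: "nrm A (block n l) \<le> sqrt (2 ^ n)"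
proof -
  have "(block n l)\<^sup>\<star> \<otimes> \<one> \<otimes> block n l
      = (\<Oplus>t\<in>{..<2 ^ (n + l)}. (probe n l t)\<^sup>\<star> \<otimes> \<one> \<otimes> probe n l t)"
    unfolding block_def
    by (intro sandwich_finsum probe_cross_zero probe_range_orthogonal_same) auto
  also have "\<dots> = of_real (2 ^ n) \<odot> \<one>"
    by (simp add: star_probe_probe sum_cylinder_pow)
  finally have "(nrm A (block n l))\<^sup>2 = 2 ^ n * nrm A \<one>"
    using cstar_identity[of "block n l"] by (simp add: nrm_smult norm_power)
  also have "\<dots> \<le> 2 ^ n"
    using nrm_one_le by simp
  finally show ?thesis
    by (rule real_le_rsqrt)
qed

lemma nrm_U_le: "nrm A U \<le> 1" and nrm_S_le: "nrm A S \<le> 1"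
  by (simp_all add: nrm_isometry_le star_U_U star_S_S)

lemma asymptotically_central_via_blocks:
  assumes b: "b \<in> carrier A"
    and le: "\<And>n. nrm A (b \<otimes> (\<Oplus>l\<in>{..<n}. block n l) \<ominus> (\<Oplus>l\<in>{..<n}. block n l) \<otimes> b) \<le> f n"
    and lim: "(\<lambda>n. 1 / sqrt (real (n * 2 ^ n)) * f n) \<longlonglongrightarrow> 0"
  shows "asymptotically_central spread b"
proof (rule asymptotically_central_bound[OF spread_closed b _ lim])
  fix n
  let ?G = "\<Oplus>l\<in>{..<n}. block n l"
  have "?G \<in> carrier A"
    by (simp add: Pi_def)
  then have "nrm A (b \<otimes> spread n \<ominus> spread n \<otimes> b)
      = 1 / sqrt (real (n * 2 ^ n)) * nrm A (b \<otimes> ?G \<ominus> ?G \<otimes> b)"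
    unfolding spread_block using b by (subst nrm_commutator_scale) (simp_all add: norm_divide)
  also have "\<dots> \<le> 1 / sqrt (real (n * 2 ^ n)) * f n"
    by (intro mult_left_mono le) simp
  finally show "nrm A (b \<otimes> spread n \<ominus> spread n \<otimes> b) \<le> 1 / sqrt (real (n * 2 ^ n)) * f n" .
qed

lemma nrm_diff_le_add:
  "x \<in> carrier A \<Longrightarrow> y \<in> carrier A \<Longrightarrow> nrm A x \<le> K \<Longrightarrow> nrm A y \<le> K \<Longrightarrow> nrm A (x \<ominus> y) \<le> 2 * K"
  using nrm_diff_le[of x y] by simp

text \<open>Each of the \<open>n\<close> levels contributes two end terms of norm at most 1, against the normalization
  \<open>1 / sqrt (n 2\<^sup>n)\<close>.\<close>

lemma asymptotically_central_U: "asymptotically_central spread U"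
  and asymptotically_central_star_U: "asymptotically_central spread (U\<^sup>\<star>)"
proof -
  have lim: "(\<lambda>n. 1 / sqrt (real (n * 2 ^ n)) * (real n * 2)) \<longlonglongrightarrow> 0"
    by real_asymp
  have U: "nrm A (U \<otimes> block n l \<ominus> block n l \<otimes> U) \<le> 2" for n l
    unfolding block_def
    by (subst telescope_forward)
      (auto simp: U_probe intro!: nrm_diff_le_add[where K = 1, simplified] order_trans[OF nrm_mult_le_right nrm_probe_le] nrm_U_le)
  have U': "nrm A (U\<^sup>\<star> \<otimes> block n l \<ominus> block n l \<otimes> U\<^sup>\<star>) \<le> 2" for n l
    unfolding block_def
    by (subst telescope_backward)
      (auto simp: star_U_probe nrm_star intro!: nrm_diff_le_add[where K = 1, simplified] order_trans[OF nrm_mult_le_left nrm_probe_le] nrm_U_le)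
  show "asymptotically_central spread U"
    by (rule asymptotically_central_via_blocks[OF _ _ lim])
      (intro nrm_commutator_finsum_le U_closed block_closed U | simp)+
  show "asymptotically_central spread (U\<^sup>\<star>)"
    by (rule asymptotically_central_via_blocks[OF _ _ lim])
      (intro nrm_commutator_finsum_le star_closed U_closed block_closed U' | simp)+
qed

text \<open>Only the first and the last block survive, each of norm at most \<open>2\<^sup>n\<^sup>/\<^sup>2\<close>, against the normalization
  \<open>1 / sqrt (n 2\<^sup>n)\<close>.\<close>

lemma asymptotically_central_S: "asymptotically_central spread S"
  and asymptotically_central_star_S: "asymptotically_central spread (S\<^sup>\<star>)"
proof -
  have lim: "(\<lambda>n. 1 / sqrt (real (n * 2 ^ n)) * (2 * sqrt (2 ^ n))) \<longlonglongrightarrow> 0"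
    by real_asymp
  have S: "nrm A (S \<otimes> (\<Oplus>l\<in>{..<n}. block n l) \<ominus> (\<Oplus>l\<in>{..<n}. block n l) \<otimes> S) \<le> 2 * sqrt (2 ^ n)" for n
    by (subst telescope_forward)
      (auto simp: S_block intro!: nrm_diff_le_add order_trans[OF nrm_mult_le_right nrm_block_le] nrm_S_le)
  have S': "nrm A (S\<^sup>\<star> \<otimes> (\<Oplus>l\<in>{..<n}. block n l) \<ominus> (\<Oplus>l\<in>{..<n}. block n l) \<otimes> S\<^sup>\<star>) \<le> 2 * sqrt (2 ^ n)" for n
    by (subst telescope_backward)
      (auto simp: star_S_block nrm_star intro!: nrm_diff_le_add order_trans[OF nrm_mult_le_left nrm_block_le] nrm_S_le)
  show "asymptotically_central spread S"
    by (rule asymptotically_central_via_blocks[OF S_closed S lim])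
  show "asymptotically_central spread (S\<^sup>\<star>)"
    by (rule asymptotically_central_via_blocks[OF star_closed[OF S_closed] S' lim])
qed

lemma asymptotically_central_Upow: "asymptotically_central spread (Upow k)"
proof (induction k rule: int_induct[where k = 0])
  case (step1 k)
  then show ?case
    by (simp add: Upow_Suc asymptotically_central_mult asymptotically_central_U)
next
  case (step2 k)
  then show ?case
    by (simp add: Upow_pred asymptotically_central_mult asymptotically_central_star_U)
qed (simp add: asymptotically_central_one)

lemma asymptotically_central_S_pow: "asymptotically_central spread (S [^] (m::nat))"
  by (induction m) (simp_all add: asymptotically_central_one asymptotically_central_mult asymptotically_central_S)

lemma asymptotically_central_star_S_pow: "asymptotically_central spread ((S [^] (m::nat))\<^sup>\<star>)"
  by (induction m)
    (simp_all add: star_mult asymptotically_central_one asymptotically_central_mult asymptotically_central_star_S)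

lemma asymptotically_central_monomial_span:
  assumes "x \<in> lspan monomials"
  shows "asymptotically_central spread x"
proof (rule asymptotically_central_lspan[OF assms monomials_subset])
  fix x assume "x \<in> monomials"
  then show "asymptotically_central spread x"
    by (auto simp: monomials_def aff_def star_mult star_Upow intro!: asymptotically_central_mult
        asymptotically_central_Upow asymptotically_central_S_pow asymptotically_central_star_S_pow)
qed simp

section \<open>Probes avoid the fixed points of monomials\<close>

text \<open>The fixed point of \<open>k \<mapsto> 2\<^sup>d k - c\<close> is \<open>c / (2\<^sup>d - 1)\<close>, and an integer in the target class of a probe
  stays off it even modulo the level \<open>2\<^sup>s\<^sup>+\<^sup>n\<close> of the probe: for \<open>d > 0\<close> the residue in question lies
  strictly between 0 and \<open>2\<^sup>s\<^sup>+\<^sup>n\<close>. For \<open>d = 0\<close> the map is a translation by \<open>- c\<close>.\<close>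

lemma dilation_not_dvd:
  fixes c t :: int
  assumes d: "d < n" "n \<le> s" and t: "0 \<le> t" "t < 2 ^ s" and c: "\<bar>c\<bar> < 2 ^ n"
    and "d = 0 \<Longrightarrow> c \<noteq> 0"
  shows "\<not> 2 ^ (s + n) dvd (2 ^ d - 1) * (t + 2 ^ s) - c"
proof (cases "d = 0")
  case True
  have "(2::int) ^ n \<le> 2 ^ (s + n)"
    by (intro power_increasing) auto
  then have "\<bar>c\<bar> < 2 ^ (s + n)"
    using c by linarith
  moreover have "c \<noteq> 0"
    using assms(6) True .
  ultimately have "\<not> 2 ^ (s + n) dvd c"
    using dvd_imp_le_int[of c "2 ^ (s + n)"] by auto
  then show ?thesis
    using True by simp
next
  case False
  have ns: "(2::int) ^ n \<le> 2 ^ s"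
    using d by (intro power_increasing) auto
  have d2: "(2::int) ^ 1 \<le> 2 ^ d"
    using False by (intro power_increasing) auto
  have "1 * 2 ^ s \<le> (2 ^ d - 1) * (t + 2 ^ s)"
    using d2 t by (intro mult_mono) auto
  then have pos: "0 < (2 ^ d - 1) * (t + 2 ^ s) - c"
    using c ns by linarith
  have "(2 ^ d - 1) * (t + 2 ^ s) \<le> (2 ^ d - 1) * (2 * 2 ^ s)"
    using d2 t by (intro mult_left_mono) auto
  also have "\<dots> = 2 ^ (Suc d + s) - 2 * 2 ^ s"
    by (simp add: power_add algebra_simps)
  also have "(2::int) ^ (Suc d + s) \<le> 2 ^ (s + n)"
    using d by (intro power_increasing) auto
  finally have "(2 ^ d - 1) * (t + 2 ^ s) - c < 2 ^ (s + n)"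
    using c ns by linarith
  with pos show ?thesis
    by (rule not_dvd_between)
qed

text \<open>The monomial is induced by a partial affine map of slope \<open>2\<^sup>m\<^sup>-\<^sup>p\<close>. A nonzero corner at the class of
  \<open>j\<close> would mean that this map fixes \<open>j\<close> modulo the level of the probe.\<close>

lemma monomial_corner_zero:
  assumes pm: "p \<le> m" "m < n" and c: "\<bar>2 ^ (m - p) * b - a\<bar> < 2 ^ n"
    and off: "m = p \<Longrightarrow> a \<noteq> b" and t: "t < 2 ^ (n + l)"
  shows "(aff (int t + 2 ^ (n + l)) (n + l + n))\<^sup>\<star> \<otimes> (aff a m \<otimes> (aff b p)\<^sup>\<star>)
     \<otimes> aff (int t + 2 ^ (n + l)) (n + l + n) = \<zero>"
proof -
  define j where "j = int t + 2 ^ (n + l)"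
  define M where "M = n + l + n"
  have M: "p \<le> M" "m \<le> M"
    using pm by (simp_all add: M_def)
  have tl: "int t < 2 ^ (n + l)"
    using t by (metis of_nat_less_iff of_nat_numeral of_nat_power)
  have eq: "(aff j M)\<^sup>\<star> \<otimes> (aff a m \<otimes> (aff b p)\<^sup>\<star>) \<otimes> aff j M
      = ((aff a m)\<^sup>\<star> \<otimes> aff j M)\<^sup>\<star> \<otimes> ((aff b p)\<^sup>\<star> \<otimes> aff j M)"
    by (simp add: star_mult m_assoc)
  have "(aff j M)\<^sup>\<star> \<otimes> (aff a m \<otimes> (aff b p)\<^sup>\<star>) \<otimes> aff j M = \<zero>"
  proof (cases "2 ^ m dvd j - a \<and> 2 ^ p dvd j - b")
    case False
    then show ?thesis
      unfolding eq star_aff_aff[OF M(1)] star_aff_aff[OF M(2)] by auto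
  next
    case True
    then obtain u v where u: "j - a = 2 ^ m * u" and v: "j - b = 2 ^ p * v"
      by (auto elim!: dvdE)
    have "\<not> 2 ^ (M - m) dvd v - u"
    proof
      assume "2 ^ (M - m) dvd v - u"
      then have "2 ^ m * 2 ^ (M - m) dvd 2 ^ m * (v - u)"
        by (rule mult_dvd_mono[OF dvd_refl])
      moreover have "(2::int) ^ m * 2 ^ (M - m) = 2 ^ (n + l + n)"
        using M by (simp add: M_def flip: power_add)
      moreover have "2 ^ m * (v - u) = 2 ^ (m - p) * (2 ^ p * v) - 2 ^ m * u"
        using pm by (simp add: algebra_simps flip: power_add)
      \<comment> \<open>This is the displacement of \<open>j\<close> under the affine map \<open>k \<mapsto> a + 2\<^sup>m\<^sup>-\<^sup>p (k - b)\<close>.\<close>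
      moreover have "2 ^ (m - p) * (2 ^ p * v) - 2 ^ m * u
          = (2 ^ (m - p) - 1) * (int t + 2 ^ (n + l)) - (2 ^ (m - p) * b - a)"
        unfolding u[symmetric] v[symmetric] j_def by (simp add: algebra_simps)
      ultimately have "2 ^ (n + l + n) dvd (2 ^ (m - p) - 1) * (int t + 2 ^ (n + l)) - (2 ^ (m - p) * b - a)"
        by metis
      moreover have "\<not> 2 ^ (n + l + n) dvd (2 ^ (m - p) - 1) * (int t + 2 ^ (n + l)) - (2 ^ (m - p) * b - a)"
        using pm c tl off by (intro dilation_not_dvd) auto
      ultimately show False
        by contradiction
    qed
    then have "(aff u (M - m))\<^sup>\<star> \<otimes> aff v (M - p) = \<zero>"
      using pm by (simp add: star_aff_aff)
    then show ?thesis
      unfolding eq star_aff_aff[OF M(1)] star_aff_aff[OF M(2)] using u v by simp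
  qed
  then show ?thesis
    by (simp add: j_def M_def)
qed

lemma eventually_less_power: "\<forall>\<^sub>F n in sequentially. (k::int) < 2 ^ n"
proof (rule eventually_sequentiallyI)
  fix n assume "nat \<bar>k\<bar> \<le> n"
  then have "\<bar>k\<bar> \<le> int n"
    by linarith
  also have "int n < 2 ^ n"
    by (rule of_nat_less_two_power)
  finally show "k < 2 ^ n"
    by linarith
qed

lemma probe_corner:
  assumes x: "x \<in> carrier A"
    and "(aff (int t + 2 ^ (n + l)) (n + l + n))\<^sup>\<star> \<otimes> x \<otimes> aff (int t + 2 ^ (n + l)) (n + l + n) = \<zero>"
  shows "(probe n l t)\<^sup>\<star> \<otimes> x \<otimes> probe n l t = \<zero>"
proof -
  let ?w = "aff (int t + 2 ^ (n + l)) (n + l + n)"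
  have "(probe n l t)\<^sup>\<star> \<otimes> x \<otimes> probe n l t = aff (int t) l \<otimes> (?w\<^sup>\<star> \<otimes> x \<otimes> ?w) \<otimes> (aff (int t) l)\<^sup>\<star>"
    using x by (simp add: probe_def star_mult m_assoc)
  then show ?thesis
    by (simp add: assms(2))
qed

text \<open>Up to taking adjoints, the monomial does not contract, which is the case treated above.\<close>

lemma eventually_probe_monomial_zero:
  assumes "\<not> (m = p \<and> a = b)"
  shows "\<forall>\<^sub>F n in sequentially. \<forall>l t. t < 2 ^ (n + l) \<longrightarrow>
     (probe n l t)\<^sup>\<star> \<otimes> (aff a m \<otimes> (aff b p)\<^sup>\<star>) \<otimes> probe n l t = \<zero>"
proof (cases "p \<le> m")
  case True
  show ?thesis
    using eventually_less_power[of "\<bar>2 ^ (m - p) * b - a\<bar>"] eventually_gt_at_top[of m]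
  proof eventually_elim
    case (elim n)
    then show ?case
      using True assms by (auto intro!: probe_corner monomial_corner_zero)
  qed
next
  case False
  show ?thesis
    using eventually_less_power[of "\<bar>2 ^ (p - m) * a - b\<bar>"] eventually_gt_at_top[of p]
  proof eventually_elim
    case (elim n)
    have "(probe n l t)\<^sup>\<star> \<otimes> (aff a m \<otimes> (aff b p)\<^sup>\<star>) \<otimes> probe n l t = \<zero>" if t: "t < 2 ^ (n + l)" for l t
    proof -
      have "(probe n l t)\<^sup>\<star> \<otimes> (aff b p \<otimes> (aff a m)\<^sup>\<star>) \<otimes> probe n l t = \<zero>"
        using False elim t by (intro probe_corner monomial_corner_zero) auto
      moreover have "(probe n l t)\<^sup>\<star> \<otimes> (aff a m \<otimes> (aff b p)\<^sup>\<star>) \<otimes> probe n l t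
          = ((probe n l t)\<^sup>\<star> \<otimes> (aff b p \<otimes> (aff a m)\<^sup>\<star>) \<otimes> probe n l t)\<^sup>\<star>"
        by (simp add: star_mult m_assoc)
      ultimately show ?thesis
        by simp
    qed
    then show ?case
      by blast
  qed
qed

text \<open>The monomials \<open>aff a m (aff a m)\<^sup>\<star>\<close> form the diagonal part; the finitely many remaining ones have
  vanishing corners at all probes once \<open>n\<close> is large.\<close>

lemma diagonal_part:
  assumes "y \<in> lspan monomials"
  shows "\<exists>d\<in>lspan cylinders. \<forall>\<^sub>F n in sequentially. \<forall>l t. t < 2 ^ (n + l) \<longrightarrow>
     (probe n l t)\<^sup>\<star> \<otimes> y \<otimes> probe n l t = (probe n l t)\<^sup>\<star> \<otimes> d \<otimes> probe n l t"
  using assms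
proof (induction rule: lspan.induct)
  case lspan_zero
  show ?case
    by (rule bexI[OF _ lspan.lspan_zero]) simp
next
  case (lspan_incl x)
  then obtain a m b p where x: "x = aff a m \<otimes> (aff b p)\<^sup>\<star>"
    by (auto simp: monomials_def)
  show ?case
  proof (cases "m = p \<and> a = b")
    case True
    then have "x \<in> lspan cylinders"
      using lspan.lspan_incl[OF cylindersI[of a m]] by (simp add: x cylinder_def)
    then show ?thesis
      by (rule bexI[rotated]) simp
  next
    case False
    show ?thesis
      using eventually_probe_monomial_zero[OF False]
      by (intro bexI[OF _ lspan.lspan_zero]) (simp add: x)
  qed
next
  case (lspan_add x y)
  note cl = lspan_closed[OF _ monomials_subset] lspan_closed[OF _ cylinders_subset]
  obtain d where d: "d \<in> lspan cylinders" and ev_d: "\<forall>\<^sub>F n in sequentially. \<forall>l t. t < 2 ^ (n + l) \<longrightarrow>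
     (probe n l t)\<^sup>\<star> \<otimes> x \<otimes> probe n l t = (probe n l t)\<^sup>\<star> \<otimes> d \<otimes> probe n l t"
    using lspan_add.IH(1) by blast
  obtain e where e: "e \<in> lspan cylinders" and ev_e: "\<forall>\<^sub>F n in sequentially. \<forall>l t. t < 2 ^ (n + l) \<longrightarrow>
     (probe n l t)\<^sup>\<star> \<otimes> y \<otimes> probe n l t = (probe n l t)\<^sup>\<star> \<otimes> e \<otimes> probe n l t"
    using lspan_add.IH(2) by blast
  show ?case
  proof (rule bexI[OF _ lspan.lspan_add[OF d e]])
    show "\<forall>\<^sub>F n in sequentially. \<forall>l t. t < 2 ^ (n + l) \<longrightarrow>
      (probe n l t)\<^sup>\<star> \<otimes> (x \<oplus> y) \<otimes> probe n l t = (probe n l t)\<^sup>\<star> \<otimes> (d \<oplus> e) \<otimes> probe n l t"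
      using ev_d ev_e
      by eventually_elim (use cl d e lspan_add.hyps in \<open>simp add: l_distr r_distr\<close>)
  qed
next
  case (lspan_scale x c)
  note cl = lspan_closed[OF _ monomials_subset] lspan_closed[OF _ cylinders_subset]
  obtain d where d: "d \<in> lspan cylinders" and ev_d: "\<forall>\<^sub>F n in sequentially. \<forall>l t. t < 2 ^ (n + l) \<longrightarrow>
     (probe n l t)\<^sup>\<star> \<otimes> x \<otimes> probe n l t = (probe n l t)\<^sup>\<star> \<otimes> d \<otimes> probe n l t"
    using lspan_scale.IH by blast
  show ?case
  proof (rule bexI[OF _ lspan.lspan_scale[OF d]])
    show "\<forall>\<^sub>F n in sequentially. \<forall>l t. t < 2 ^ (n + l) \<longrightarrow>
      (probe n l t)\<^sup>\<star> \<otimes> (c \<odot> x) \<otimes> probe n l t = (probe n l t)\<^sup>\<star> \<otimes> (c \<odot> d) \<otimes> probe n l t"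
      using ev_d
      by eventually_elim (use cl d lspan_scale.hyps in \<open>simp add: smult_mult_left smult_mult_right\<close>)
  qed
qed

lemma lspan_cylinders_subset: "x \<in> lspan cylinders \<Longrightarrow> x \<in> lspan monomials"
proof (induction rule: lspan.induct)
  case (lspan_incl x)
  then show ?case
    using monomialsI by (elim cylindersE) (simp add: cylinder_def lspan.lspan_incl)
qed (auto intro: lspan.intros)

section \<open>The commutant of the diagonal\<close>

text \<open>Let \<open>y\<close> be a combination of monomials close to \<open>x\<close>, with diagonal part \<open>d\<close>, and let \<open>V\<close> be a
  spreading isometry with large index. The error \<open>u = y - d\<close> almost commutes with \<open>V\<close>, so it is close
  to \<open>V\<^sup>\<star>uV = V\<^sup>\<star>(x - d)V - V\<^sup>\<star>(x - y)V\<close>. The second term is small. So is the first, because \<open>x - d\<close> lies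
  in the commutant of the diagonal and has the same corners at the probes as \<open>x - y\<close>.\<close>

lemma commutant_diagonal_subset:
  assumes generated: "cstar_subalgebra A hull {U, S} = carrier A"
    and x: "x \<in> carrier A" and comm: "\<And>b m. x \<otimes> cylinder b m = cylinder b m \<otimes> x"
  shows "x \<in> closed_linear_span A cylinders"
  unfolding closed_linear_span_iff[OF cylinders_subset]
proof (intro conjI allI impI x)
  fix \<epsilon> :: real assume "\<epsilon> > 0"
  define \<delta> where "\<delta> = \<epsilon> / 4"
  have \<delta>: "\<delta> > 0"
    using \<open>\<epsilon> > 0\<close> by (simp add: \<delta>_def)
  obtain y where y: "y \<in> lspan monomials" "nrm A (x \<ominus> y) < \<delta>"
    using monomials_dense[OF generated x \<delta>] by blast
  obtain d where d: "d \<in> lspan cylinders" and ev: "\<forall>\<^sub>F n in sequentially. \<forall>l t. t < 2 ^ (n + l) \<longrightarrow>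
     (probe n l t)\<^sup>\<star> \<otimes> y \<otimes> probe n l t = (probe n l t)\<^sup>\<star> \<otimes> d \<otimes> probe n l t"
    using diagonal_part[OF y(1)] by blast
  have yc: "y \<in> carrier A" and dc: "d \<in> carrier A"
    using lspan_closed[OF y(1) monomials_subset] lspan_closed[OF d cylinders_subset] by auto
  define u where "u = y \<ominus> d"
  have u: "u \<in> carrier A"
    using yc dc by (simp add: u_def)
  have "u \<in> lspan monomials"
    unfolding u_def a_minus_def
    using lspan_add[OF y(1) lspan_scale[OF lspan_cylinders_subset[OF d], of "-1"]] dc
    by (simp add: scale_minus_one)
  then have "\<forall>\<^sub>F n in sequentially. nrm A (u \<otimes> spread n \<ominus> spread n \<otimes> u) < \<delta>"
    using asymptotically_central_monomial_span order_tendstoD(2)[OF _ \<delta>]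
    unfolding asymptotically_central_def by blast
  then have "\<forall>\<^sub>F n in sequentially. nrm A (u \<otimes> spread n \<ominus> spread n \<otimes> u) < \<delta> \<and> 0 < n \<and>
      (\<forall>l t. t < 2 ^ (n + l) \<longrightarrow>
         (probe n l t)\<^sup>\<star> \<otimes> y \<otimes> probe n l t = (probe n l t)\<^sup>\<star> \<otimes> d \<otimes> probe n l t)"
    using ev eventually_gt_at_top[of 0] by eventually_elim blast
  then obtain n where n: "nrm A (u \<otimes> spread n \<ominus> spread n \<otimes> u) < \<delta>" "0 < n"
    and yd: "\<And>l t. t < 2 ^ (n + l) \<Longrightarrow>
         (probe n l t)\<^sup>\<star> \<otimes> y \<otimes> probe n l t = (probe n l t)\<^sup>\<star> \<otimes> d \<otimes> probe n l t"
    by (auto dest: eventually_happens)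
  define V where "V = spread n"
  have V: "V \<in> carrier A" and VV: "V\<^sup>\<star> \<otimes> V = \<one>"
    using spread_isometry[OF n(2)] by (simp_all add: V_def)
  have V1: "nrm A V \<le> 1" "nrm A (V\<^sup>\<star>) \<le> 1"
    using nrm_isometry_le[OF V VV] V by (simp_all add: nrm_star)
  have corner: "nrm A (V\<^sup>\<star> \<otimes> (x \<ominus> d) \<otimes> V) \<le> nrm A (x \<ominus> y)"
    unfolding V_def
  proof (rule nrm_spread_sandwich_le[OF n(2)])
    fix b m
    have "d \<otimes> cylinder b m = cylinder b m \<otimes> d"
      by (rule lspan_commute[OF d cylinders_subset])
        (auto elim!: cylindersE intro: cylinder_commute)
    then show "(x \<ominus> d) \<otimes> cylinder b m = cylinder b m \<otimes> (x \<ominus> d)"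
      using x dc comm by (simp add: a_minus_def l_distr r_distr l_minus r_minus)
  next
    fix l t :: nat
    assume "t < 2 ^ (n + l)"
    then show "(probe n l t)\<^sup>\<star> \<otimes> (x \<ominus> d) \<otimes> probe n l t = (probe n l t)\<^sup>\<star> \<otimes> (x \<ominus> y) \<otimes> probe n l t"
      using x dc yc yd by (simp add: a_minus_def l_distr r_distr l_minus r_minus)
  qed (use x dc yc in auto)
  have le: "nrm A (V\<^sup>\<star> \<otimes> z) \<le> nrm A z" "nrm A (z \<otimes> V) \<le> nrm A z" if "z \<in> carrier A" for z
    using that V V1 by (simp_all add: nrm_mult_le_left nrm_mult_le_right)
  have "u = \<ominus> (V\<^sup>\<star> \<otimes> (u \<otimes> V \<ominus> V \<otimes> u)) \<oplus> V\<^sup>\<star> \<otimes> u \<otimes> V"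
  proof -
    have "\<ominus> (V\<^sup>\<star> \<otimes> (u \<otimes> V \<ominus> V \<otimes> u)) \<oplus> V\<^sup>\<star> \<otimes> u \<otimes> V = (V\<^sup>\<star> \<otimes> V) \<otimes> u"
      using u V star_closed[OF V] by algebra
    then show ?thesis
      using u by (simp add: VV)
  qed
  then have "nrm A u \<le> nrm A (V\<^sup>\<star> \<otimes> (u \<otimes> V \<ominus> V \<otimes> u)) + nrm A (V\<^sup>\<star> \<otimes> u \<otimes> V)"
    using nrm_triangle[of "\<ominus> (V\<^sup>\<star> \<otimes> (u \<otimes> V \<ominus> V \<otimes> u))" "V\<^sup>\<star> \<otimes> u \<otimes> V"] u V by (simp add: nrm_minus)
  also have "nrm A (V\<^sup>\<star> \<otimes> (u \<otimes> V \<ominus> V \<otimes> u)) < \<delta>"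
    using le(1)[of "u \<otimes> V \<ominus> V \<otimes> u"] n(1) u V by (simp add: V_def)
  also have "V\<^sup>\<star> \<otimes> u \<otimes> V = V\<^sup>\<star> \<otimes> (x \<ominus> d) \<otimes> V \<ominus> V\<^sup>\<star> \<otimes> (x \<ominus> y) \<otimes> V"
    unfolding u_def using x yc dc V star_closed[OF V] by algebra
  also have "nrm A \<dots> \<le> nrm A (V\<^sup>\<star> \<otimes> (x \<ominus> d) \<otimes> V) + nrm A (V\<^sup>\<star> \<otimes> (x \<ominus> y) \<otimes> V)"
    using x yc dc V by (simp add: nrm_diff_le)
  also have "nrm A (V\<^sup>\<star> \<otimes> (x \<ominus> y) \<otimes> V) \<le> nrm A (x \<ominus> y)"
    using le(2)[of "V\<^sup>\<star> \<otimes> (x \<ominus> y)"] le(1)[of "x \<ominus> y"] x yc V by simp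
  finally have "nrm A u < 3 * \<delta>"
    using corner y(2) by simp
  moreover have "nrm A (x \<ominus> d) \<le> nrm A (x \<ominus> y) + nrm A u"
    unfolding u_def using nrm_diff_triangle x yc dc by simp
  ultimately have "nrm A (x \<ominus> d) < \<epsilon>"
    using y(2) by (simp add: \<delta>_def)
  then show "\<exists>d\<in>lspan cylinders. nrm A (x \<ominus> d) < \<epsilon>"
    using d by blast
qed

end

theorem theorem3p9:
  fixes Q\<^sub>2 :: "'a cstar" and U S\<^sub>2 :: 'a
  assumes "is_two_adic_ring_cstar_algebra Q\<^sub>2 U S\<^sub>2"
  shows "maximal_abelian_subalgebra Q\<^sub>2 (diagonal_subalgebra Q\<^sub>2 U S\<^sub>2)"
proof -
  interpret two_adic Q\<^sub>2 U S\<^sub>2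
    using assms by (simp add: is_two_adic_ring_cstar_algebra_def two_adic_def two_adic_axioms_def)
  have generated: "cstar_subalgebra Q\<^sub>2 hull {U, S\<^sub>2} = carrier Q\<^sub>2"
    using assms by (simp add: is_two_adic_ring_cstar_algebra_def)
  let ?D = "closed_linear_span Q\<^sub>2 cylinders"
  have "C = ?D" if C: "abelian_cstar_subalgebra Q\<^sub>2 C" and sub: "?D \<subseteq> C" for C
  proof
    interpret C: submodule C complex_ring Q\<^sub>2
      using C by (simp add: abelian_cstar_subalgebra_def cstar_subalgebra_def)
    show "C \<subseteq> ?D"
    proof
      fix x assume x: "x \<in> C"
      have "cylinder b m \<in> C" for b m
        using sub lspan_subset_closed_linear_span[OF cylinders_subset lspan_incl[OF cylindersI]] by blast
      then show "x \<in> ?D"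
        using C x C.subset unfolding abelian_cstar_subalgebra_def
        by (intro commutant_diagonal_subset[OF generated]) auto
    qed
  qed (rule sub)
  then show ?thesis
    using abelian_diagonal by (simp add: maximal_abelian_subalgebra_def diagonal_subalgebra_eq)
qed

end
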